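(* Let $q$ be a prime power, $n\ge1$, let $\mathbf{g}=(g_1,\dots,g_n)$ be positive integers and $\boldsymbol{\rho}=(\rho_1,\dots,\rho_n)$ with $\rho_i>0$, $\sum_i\rho_i=1$. Information packets are partitioned into disjoint generations $G_1,\dots,G_n$ with $|G_i|=g_i$. At each transmission (over a perfect channel) the source independently chooses generation $G_i$ with probability $\rho_i$ and sends a linear combination of its packets with coefficient vector drawn uniformly from $GF(q)^{g_i}$, independently of everything else. Let $M_i$ be the number of coded packets of $G_i$ received at the moment $G_i$ first has $g_i$ linearly independent coefficient vectors (so the $M_i$ are independent and $M_i$ is distributed as the number of i.i.d.\ uniform vectors in $GF(q)^{g_i}$ needed to span $GF(q)^{g_i}$), and let $W(\boldsymbol{\rho},\mathbf{g})$ be the total number of coded packets transmitted until all generations are decodable. Then \[ E[W(\boldsymbol{\rho},\mathbf{g})]=\int_0^\infty\Bigl(1-\prod_{i=1}^n\bigl(1-e^{-\rho_ix}E_{M_i}[S_{M_i}(\rho_ix)]\bigr)\Bigr)dx \] \[ <\int_0^\infty\Bigl(1-\prod_{i=1}^n\Bigl(1-e^{-\rho_ix}\bigl(S_{g_i}(\rho_ix)+\alpha_{q,g_i}q^{g_i}e^{\rho_ix/q}-\alpha_{q,g_i}q^{g_i}S_{g_i}(\rho_ix/q)\bigr)\Bigr)\Bigr)dx, \] and \[ E[W^2(\boldsymbol{\rho},\mathbf{g})]=2\int_0^\infty x\Bigl(1-\sum_{i=1}^n\rho_i\frac{1-E_{M_i}[S_{M_i-1}(\rho_ix)]e^{-\rho_ix}}{1-E_{M_i}[S_{M_i}(\rho_ix)]e^{-\rho_ix}}\prod_{j=1}^n\bigl(1-E_{M_j}[S_{M_j}(\rho_jx)]e^{-\rho_jx}\bigr)\Bigr)dx+\int_0^\infty\Bigl(1-\prod_{i=1}^n\bigl(1-e^{-\rho_ix}E_{M_i}[S_{M_i}(\rho_ix)]\bigr)\Bigr)dx,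 \] where $\alpha_{q,g_i}=-\sum_{k=0}^{g_i-1}\ln(1-q^{k-g_i})$ for $i=1,\dots,n$.
   Context: For an integer $m\ge1$, $S_m(x)=\sum_{j=0}^{m-1}\frac{x^j}{j!}$; $S_m(x)=0$ for $m\le 0$; $S_\infty(x)=e^x$. $E_{M_i}[\cdot]$ denotes expectation over the random variable $M_i$. *)

theory Defs
  imports "HOL-Probability.Probability"
begin

definition S :: "nat \<Rightarrow> real \<Rightarrow> real" where
  "S m x = (\<Sum>j<m. x ^ j / fact j)"

definition alpha :: "nat \<Rightarrow> nat \<Rightarrow> real" where
  "alpha q g = - (\<Sum>k<g. ln (1 - 1 / real q ^ (g - k)))"

definition gen_pmf :: "nat \<Rightarrow> (nat \<Rightarrow> real) \<Rightarrow> nat pmf" where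
  "gen_pmf n \<rho> = embed_pmf (\<lambda>i. if i < n then \<rho> i else 0)"

text \<open>GF(q)^m, represented as functions nat => F vanishing from index m on.\<close>
definition coef_vectors :: "nat \<Rightarrow> (nat \<Rightarrow> 'a::zero) set" where
  "coef_vectors m = {v. \<forall>j. m \<le> j \<longrightarrow> v j = 0}"

definition tx_pmf :: "nat \<Rightarrow> (nat \<Rightarrow> real) \<Rightarrow> (nat \<Rightarrow> nat) \<Rightarrow> (nat \<times> (nat \<Rightarrow> 'a::{field,finite})) pmf" where
  "tx_pmf n \<rho> g = bind_pmf (gen_pmf n \<rho>)
     (\<lambda>i. map_pmf (\<lambda>v. (i, v)) (pmf_of_set (coef_vectors (g i))))"

definition channel :: "nat \<Rightarrow> (nat \<Rightarrow> real) \<Rightarrow> (nat \<Rightarrow> nat) \<Rightarrow> (nat \<times> (nat \<Rightarrow> 'a::{field,finite})) stream measure" where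
  "channel n \<rho> g = stream_space (measure_pmf (tx_pmf n \<rho> g))"

definition spans :: "nat \<Rightarrow> (nat \<Rightarrow> 'a::field) set \<Rightarrow> bool" where
  "spans m V \<longleftrightarrow> (\<forall>w \<in> coef_vectors m. \<exists>c. w = (\<lambda>j. \<Sum>v\<in>V. c v * v j))"

definition received :: "nat \<Rightarrow> nat \<Rightarrow> (nat \<times> (nat \<Rightarrow> 'a)) stream \<Rightarrow> (nat \<Rightarrow> 'a) set" where
  "received i t \<omega> = {snd (\<omega> !! s) | s. s < t \<and> fst (\<omega> !! s) = i}"

definition decodable :: "(nat \<Rightarrow> nat) \<Rightarrow> nat \<Rightarrow> nat \<Rightarrow> (nat \<times> (nat \<Rightarrow> 'a::field)) stream \<Rightarrow> bool" where
  "decodable g i t \<omega> \<longleftrightarrow> spans (g i) (received i t \<omega>)"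

definition decode_time :: "(nat \<Rightarrow> nat) \<Rightarrow> nat \<Rightarrow> (nat \<times> (nat \<Rightarrow> 'a::field)) stream \<Rightarrow> nat" where
  "decode_time g i \<omega> = (LEAST t. decodable g i t \<omega>)"

definition M_count :: "(nat \<Rightarrow> nat) \<Rightarrow> nat \<Rightarrow> (nat \<times> (nat \<Rightarrow> 'a::field)) stream \<Rightarrow> nat" where
  "M_count g i \<omega> = card {s. s < decode_time g i \<omega> \<and> fst (\<omega> !! s) = i}"

definition W_total :: "nat \<Rightarrow> (nat \<Rightarrow> nat) \<Rightarrow> (nat \<times> (nat \<Rightarrow> 'a::field)) stream \<Rightarrow> nat" where
  "W_total n g \<omega> = (LEAST t. \<forall>i<n. decodable g i t \<omega>)"

end

theory Submission
  imports Defs "HOL-Library.Function_Algebras"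
begin

text \<open>Weighting the number of transmissions by an exponential generating function (Poissonization)
  decouples the generations: a word over the disjoint union of the alphabets is a shuffle of words
  over the single alphabets, so the exponential generating function of the probability that
  everything is decodable after t packets is the product of those of the single generations.
  Since x^t e^(-x) / t! has integral 1 over the half-line, integrating the generating function of
  P(W > t) gives the first moment, and integrating x times its derivative the sum of t P(W > t).

  For the bound, let p(k) be the probability that k uniform vectors span and c(k) the
  coefficient of y^k / k! in the bounding series. Although the resulting factors 1 - T may be negative,
  the inequalities 1 - p(k) \<le> c(k) \<le> 1 + p(k) show that they are dominated in absolute
  value by the true factors 1 - e^(-y) E[S_M(y)]. The second inequality is critical at k = g, where it
  says \<alpha> \<le> 1 + e^(-\<alpha>); this holds because the product of (1 - q^(-r)) over r
  is at least 9/32.\<close>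

section \<open>Exponential generating functions and weighted sums over words\<close>

text \<open>No Poisson process is constructed: independence of the generations enters only through
  the Cauchy product of series, and the continuous variable x only through Gamma integrals. The
  series that are integrated have nonnegative terms, so both moment identities hold in [0, infinity]
  by exchanging sum and integral. The quotient in the second moment is a logarithmic derivative.
  Shifting a sequence by one differentiates its generating function, and the shifted series of a
  single generation is the one that belongs to M - 1 in place of M. The coefficients c(k) come from
  bounding 1 - p(k) by - ln p(k) and this, by concavity of ln, by \<alpha> q^(g - k). Two further
  points shape the argument: a comparison of coefficients that is strict at one index k is already
  strict for the functions at every positive argument, and the strict inequality between the
  integrals requires finiteness, which comes from the geometric tail of c.\<close>

definition egf :: "(nat \<Rightarrow> real) \<Rightarrow> real \<Rightarrow> real" where
  "egf c x = (\<Sum>k. c k / fact k * x ^ k)"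

text \<open>Absolute convergence at every point is the hypothesis of the Cauchy product.\<close>

definition entire_egf :: "(nat \<Rightarrow> real) \<Rightarrow> bool" where
  "entire_egf c \<longleftrightarrow> (\<forall>x. summable (\<lambda>k. \<bar>c k / fact k * x ^ k\<bar>))"

lemma entire_egf_bounded:
  assumes "\<And>k. \<bar>c k\<bar> \<le> C * B ^ k"
  shows "entire_egf c"
  unfolding entire_egf_def
proof (rule allI, rule summable_comparison_test')
  fix x :: real
  show "summable (\<lambda>k. C * ((B * \<bar>x\<bar>) ^ k /\<^sub>R fact k))"
    by (intro summable_mult summable_exp_generic)
  fix k :: nat
  have "\<bar>c k\<bar> * \<bar>x\<bar> ^ k \<le> C * B ^ k * \<bar>x\<bar> ^ k"
    by (intro mult_right_mono assms) auto
  then show "norm \<bar>c k / fact k * x ^ k\<bar> \<le> C * ((B * \<bar>x\<bar>) ^ k /\<^sub>R fact k)"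
    by (simp add: abs_mult power_abs power_mult_distrib field_simps)
qed

lemma sums_egf: "entire_egf c \<Longrightarrow> (\<lambda>k. c k / fact k * x ^ k) sums egf c x"
  unfolding egf_def entire_egf_def by (rule summable_sums, rule summable_rabs_cancel) simp

lemma egf_add:
  assumes "entire_egf a" "entire_egf b"
  shows "entire_egf (\<lambda>k. a k + b k)" "egf (\<lambda>k. a k + b k) x = egf a x + egf b x"
proof -
  show "egf (\<lambda>k. a k + b k) x = egf a x + egf b x"
    using sums_add[OF sums_egf[OF assms(1)] sums_egf[OF assms(2)], of x, THEN sums_unique]
    by (simp add: egf_def algebra_simps add_divide_distrib)
  show "entire_egf (\<lambda>k. a k + b k)"
    unfolding entire_egf_def
  proof
    fix x
    show "summable (\<lambda>k. \<bar>(a k + b k) / fact k * x ^ k\<bar>)"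
    proof (rule summable_comparison_test')
      show "summable (\<lambda>k. \<bar>a k / fact k * x ^ k\<bar> + \<bar>b k / fact k * x ^ k\<bar>)"
        using assms by (auto simp: entire_egf_def intro: summable_add)
      show "norm \<bar>(a k + b k) / fact k * x ^ k\<bar> \<le> \<bar>a k / fact k * x ^ k\<bar> + \<bar>b k / fact k * x ^ k\<bar>" for k
        using abs_triangle_ineq[of "a k / fact k * x ^ k" "b k / fact k * x ^ k"]
        by (simp add: algebra_simps add_divide_distrib)
    qed
  qed
qed

lemma egf_diff:
  assumes "entire_egf a" "entire_egf b"
  shows "entire_egf (\<lambda>k. a k - b k)" "egf (\<lambda>k. a k - b k) x = egf a x - egf b x"
proof -
  have b: "entire_egf (\<lambda>k. - b k)" "egf (\<lambda>k. - b k) x = - egf b x"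
    using assms(2) sums_minus[OF sums_egf[OF assms(2)], of x, THEN sums_unique]
    by (auto simp: entire_egf_def egf_def)
  show "entire_egf (\<lambda>k. a k - b k)" "egf (\<lambda>k. a k - b k) x = egf a x - egf b x"
    using egf_add[OF assms(1) b(1)] b(2) by simp_all
qed

lemma egf_pos:
  assumes "entire_egf c" "\<And>k. 0 \<le> c k" "0 < c m" "0 < x"
  shows "0 < egf c x"
  unfolding egf_def
  by (rule suminf_pos2[where i = m]) (use assms sums_egf[OF assms(1), of x] in \<open>auto simp: sums_iff\<close>)

lemma entire_egf_one: "entire_egf (\<lambda>_. 1)"
  by (rule entire_egf_bounded[where B = 1 and C = 1]) simp

lemma egf_one: "egf (\<lambda>_. 1) x = exp x"
  by (simp add: egf_def exp_def divide_inverse)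

lemma egf_delta: "egf (\<lambda>k. if k = 0 then c else 0) x = c"
  unfolding egf_def by (subst suminf_finite[of "{0}"]) auto

lemma egf_scale: "egf (\<lambda>k. b ^ k * c k) x = egf c (b * x)"
  by (simp add: egf_def power_mult_distrib mult_ac)

lemma egf_mult:
  assumes "entire_egf a" "entire_egf b"
  shows "egf a x * egf b x = egf (\<lambda>t. \<Sum>k\<le>t. real (t choose k) * (a k * b (t - k))) x"
proof -
  have "egf a x * egf b x =
      (\<Sum>t. \<Sum>k\<le>t. (a k / fact k * x ^ k) * (b (t - k) / fact (t - k) * x ^ (t - k)))"
    unfolding egf_def
    by (rule Cauchy_product) (use assms in \<open>auto simp: entire_egf_def\<close>)
  also have "(\<lambda>t. \<Sum>k\<le>t. (a k / fact k * x ^ k) * (b (t - k) / fact (t - k) * x ^ (t - k)))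
      = (\<lambda>t. (\<Sum>k\<le>t. real (t choose k) * (a k * b (t - k))) / fact t * x ^ t)"
  proof
    fix t
    have "(a k / fact k * x ^ k) * (b (t - k) / fact (t - k) * x ^ (t - k))
        = real (t choose k) * (a k * b (t - k)) / fact t * x ^ t" if "k \<le> t" for k
    proof -
      have "x ^ t = x ^ k * x ^ (t - k)"
        using that by (simp flip: power_add)
      then show ?thesis
        using that by (simp add: binomial_fact field_simps)
    qed
    then show "(\<Sum>k\<le>t. (a k / fact k * x ^ k) * (b (t - k) / fact (t - k) * x ^ (t - k)))
        = (\<Sum>k\<le>t. real (t choose k) * (a k * b (t - k))) / fact t * x ^ t"
      by (simp add: sum_divide_distrib sum_distrib_right)
  qed
  finally show ?thesis
    by (simp add: egf_def)
qed

lemma DERIV_egf: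
  assumes "entire_egf c"
  shows "(egf c has_real_derivative egf (\<lambda>k. c (Suc k)) x) (at x)"
proof -
  have "diffs (\<lambda>k. c k / fact k) = (\<lambda>k. c (Suc k) / fact k)"
    by (auto simp: diffs_def fun_eq_iff simp del: of_nat_Suc)
  moreover have "((\<lambda>x. \<Sum>k. c k / fact k * x ^ k) has_real_derivative
      (\<Sum>k. diffs (\<lambda>k. c k / fact k) k * x ^ k)) (at x)"
    by (rule termdiffs_strong_converges_everywhere)
       (use sums_egf[OF assms] in \<open>auto simp: sums_iff\<close>)
  ultimately show ?thesis
    by (simp add: egf_def[abs_def])
qed

section \<open>Weighted sums over words and their shuffles\<close>

primrec word_sum :: "'b set \<Rightarrow> ('b \<Rightarrow> real) \<Rightarrow> nat \<Rightarrow> ('b list \<Rightarrow> real) \<Rightarrow> real" where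
  "word_sum A w 0 f = f []"
| "word_sum A w (Suc t) f = (\<Sum>a\<in>A. w a * word_sum A w t (\<lambda>xs. f (a # xs)))"

lemma word_sum_cong:
  assumes "\<And>a. a \<in> A \<Longrightarrow> w a = w' a" and "\<And>xs. set xs \<subseteq> A \<Longrightarrow> f xs = h xs"
  shows "word_sum A w t f = word_sum A w' t h"
  using assms(2)
proof (induction t arbitrary: f h)
  case (Suc t)
  have "word_sum A w t (\<lambda>xs. f (a # xs)) = word_sum A w' t (\<lambda>xs. h (a # xs))" if "a \<in> A" for a
    by (rule Suc.IH) (use Suc.prems that in auto)
  then show ?case
    using assms(1) by simp
qed simp

lemma word_sum_empty: "word_sum {} w t f = (if t = 0 then f [] else 0)"
  by (cases t) auto

lemma abs_word_sum_le:
  assumes "\<And>a. a \<in> A \<Longrightarrow> 0 \<le> w a" and "\<And>xs. \<bar>f xs\<bar> \<le> 1"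
  shows "\<bar>word_sum A w t f\<bar> \<le> (\<Sum>a\<in>A. w a) ^ t"
  using assms(2)
proof (induction t arbitrary: f)
  case (Suc t)
  have "\<bar>word_sum A w (Suc t) f\<bar> \<le> (\<Sum>a\<in>A. \<bar>w a * word_sum A w t (\<lambda>xs. f (a # xs))\<bar>)"
    by simp
  also have "\<dots> \<le> (\<Sum>a\<in>A. w a * (\<Sum>a\<in>A. w a) ^ t)"
    by (intro sum_mono) (auto simp: abs_mult assms(1) intro!: mult_left_mono Suc)
  finally show ?case
    by (simp add: sum_distrib_right)
qed simp

lemma word_sum_scale: "word_sum A (\<lambda>a. c * w a) t f = c ^ t * word_sum A w t f"
  by (induction t arbitrary: f) (simp_all add: sum_distrib_left mult_ac)

lemma word_sum_image:
  assumes "inj_on h A"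
  shows "word_sum (h ` A) w t f = word_sum A (\<lambda>a. w (h a)) t (\<lambda>xs. f (map h xs))"
  using assms by (induction t arbitrary: f) (simp_all add: sum.reindex)

text \<open>A word over a disjoint union is given by its two subwords and the choice of the k
  positions in \<open>A\<close>, whence the binomial coefficient. In the induction the first letter
  goes to one of the two subwords, and the two contributions combine by Pascal's rule;
  \<open>f\<close> and \<open>h\<close> vary because they absorb that letter.\<close>

lemma word_sum_shuffle:
  assumes "finite A" "finite B" and disj: "A \<inter> B = {}"
  shows "word_sum (A \<union> B) w t (\<lambda>xs. f (filter (\<lambda>a. a \<in> A) xs) * h (filter (\<lambda>a. a \<in> B) xs))
    = (\<Sum>k\<le>t. real (t choose k) * (word_sum A w k f * word_sum B w (t - k) h))"
proof (induction t arbitrary: f h)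
  case (Suc t)
  let ?F = "\<lambda>f k. word_sum A w k f" and ?H = "\<lambda>h k. word_sum B w k h"
  let ?conv = "\<lambda>f h t. \<Sum>k\<le>t. real (t choose k) * (?F f k * ?H h (t - k))"
  have inA: "a \<in> A \<Longrightarrow> a \<notin> B" and inB: "a \<in> B \<Longrightarrow> a \<notin> A" for a
    using disj by auto
  have "word_sum (A \<union> B) w (Suc t) (\<lambda>xs. f (filter (\<lambda>a. a \<in> A) xs) * h (filter (\<lambda>a. a \<in> B) xs))
      = (\<Sum>a\<in>A. w a * ?conv (\<lambda>xs. f (a # xs)) h t) + (\<Sum>a\<in>B. w a * ?conv f (\<lambda>xs. h (a # xs)) t)"
  proof -
    have "word_sum (A \<union> B) w t (\<lambda>xs. f (a # filter (\<lambda>a. a \<in> A) xs) * h (filter (\<lambda>a. a \<in> B) xs))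
        = ?conv (\<lambda>xs. f (a # xs)) h t" for a
      by (rule Suc.IH)
    moreover have "word_sum (A \<union> B) w t (\<lambda>xs. f (filter (\<lambda>a. a \<in> A) xs) * h (a # filter (\<lambda>a. a \<in> B) xs))
        = ?conv f (\<lambda>xs. h (a # xs)) t" for a
      by (rule Suc.IH)
    ultimately show ?thesis
      using assms by (simp add: sum.union_disjoint inA inB cong: sum.cong)
  qed
  also have "(\<Sum>a\<in>A. w a * ?conv (\<lambda>xs. f (a # xs)) h t)
      = (\<Sum>k\<le>t. \<Sum>a\<in>A. w a * (real (t choose k) * (?F (\<lambda>xs. f (a # xs)) k * ?H h (t - k))))"
    unfolding sum_distrib_left by (rule sum.swap)
  also have "\<dots> = (\<Sum>k\<le>t. real (t choose k) * (?F f (Suc k) * ?H h (t - k)))"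
    by (simp add: sum_distrib_right sum_distrib_left mult_ac)
  also have "(\<Sum>a\<in>B. w a * ?conv f (\<lambda>xs. h (a # xs)) t)
      = (\<Sum>k\<le>t. \<Sum>a\<in>B. w a * (real (t choose k) * (?F f k * ?H (\<lambda>xs. h (a # xs)) (t - k))))"
    unfolding sum_distrib_left by (rule sum.swap)
  also have "\<dots> = (\<Sum>k\<le>t. real (t choose k) * (?F f k * ?H h (Suc (t - k))))"
    by (simp add: sum_distrib_right sum_distrib_left mult_ac)
  \<comment> \<open>The added summand \<open>k = Suc t\<close> vanishes because
    \<open>t choose Suc t\<close> is 0; with the longer range the term \<open>k = 0\<close> can be
    split off and the rest shifted.\<close>
  also have "\<dots> = (\<Sum>k\<le>Suc t. real (t choose k) * (?F f k * ?H h (Suc t - k)))"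
    by (simp add: Suc_diff_le)
  also have "\<dots> = ?F f 0 * ?H h (Suc t) + (\<Sum>k\<le>t. real (t choose Suc k) * (?F f (Suc k) * ?H h (t - k)))"
    by (subst sum.atMost_Suc_shift) (simp del: word_sum.simps)
  finally have "word_sum (A \<union> B) w (Suc t) (\<lambda>xs. f (filter (\<lambda>a. a \<in> A) xs) * h (filter (\<lambda>a. a \<in> B) xs))
      = ?F f 0 * ?H h (Suc t) + (\<Sum>k\<le>t. real (Suc t choose Suc k) * (?F f (Suc k) * ?H h (t - k)))"
    by (simp add: algebra_simps sum.distrib del: word_sum.simps)
  also have "\<dots> = ?conv f h (Suc t)"
    by (subst sum.atMost_Suc_shift) (simp del: word_sum.simps)
  finally show ?case .
qed simp

lemma egf_word_sum_union:
  assumes "finite A" "finite B" and "A \<inter> B = {}"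
    and w: "\<And>a. a \<in> A \<union> B \<Longrightarrow> 0 \<le> w a"
    and "\<And>xs. \<bar>f xs\<bar> \<le> 1" "\<And>xs. \<bar>h xs\<bar> \<le> 1"
  shows "egf (\<lambda>t. word_sum (A \<union> B) w t
            (\<lambda>xs. f (filter (\<lambda>a. a \<in> A) xs) * h (filter (\<lambda>a. a \<in> B) xs))) x
       = egf (\<lambda>t. word_sum A w t f) x * egf (\<lambda>t. word_sum B w t h) x"
proof -
  have "entire_egf (\<lambda>t. word_sum A w t f)"
    by (rule entire_egf_bounded[where C = 1 and B = "\<Sum>a\<in>A. w a"])
      (use assms in \<open>auto intro: abs_word_sum_le\<close>)
  moreover have "entire_egf (\<lambda>t. word_sum B w t h)"
    by (rule entire_egf_bounded[where C = 1 and B = "\<Sum>a\<in>B. w a"])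
      (use assms in \<open>auto intro: abs_word_sum_le\<close>)
  ultimately show ?thesis
    using assms by (simp add: word_sum_shuffle egf_mult)
qed

section \<open>Spans of random vectors over a finite field\<close>

definition scale_fun :: "'a::field \<Rightarrow> (nat \<Rightarrow> 'a) \<Rightarrow> nat \<Rightarrow> 'a" where
  "scale_fun c v = (\<lambda>j. c * v j)"

interpretation coef_space: vector_space scale_fun
  by unfold_locales (auto simp: scale_fun_def fun_eq_iff algebra_simps)

lemma sum_fun_apply: "(\<Sum>v\<in>V. f v) j = (\<Sum>v\<in>V. f v j)"
  by (induction V rule: infinite_finite_induct) auto

lemma spans_iff_span:
  assumes "finite V"
  shows "spans m V \<longleftrightarrow> coef_vectors m \<subseteq> coef_space.span V"
  unfolding spans_def coef_space.span_finite[OF assms]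
  by (auto simp: image_iff fun_eq_iff subset_iff sum_fun_apply scale_fun_def)

lemma subspace_coef_vectors: "coef_space.subspace (coef_vectors m)"
  by (auto simp: coef_space.subspace_def coef_vectors_def scale_fun_def)

lemma bij_betw_coef_vectors:
  "bij_betw (\<lambda>v. restrict v {..<m}) (coef_vectors m) (PiE {..<m} (\<lambda>_. UNIV))"
proof (rule bij_betwI[where g = "\<lambda>f j. if j < m then f j else 0"])
  show "(\<lambda>f j. if j < m then f j else 0) \<in> (PiE {..<m} (\<lambda>_. UNIV)) \<rightarrow> coef_vectors m"
    by (auto simp: coef_vectors_def)
qed (auto simp: coef_vectors_def fun_eq_iff PiE_iff extensional_def)

lemma finite_coef_vectors: "finite (coef_vectors m :: (nat \<Rightarrow> 'a::{zero,finite}) set)"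
  using bij_betw_finite[OF bij_betw_coef_vectors[of m, where 'a = 'a]] by (simp add: finite_PiE)

lemma card_coef_vectors: "card (coef_vectors m :: (nat \<Rightarrow> 'a::{zero,finite}) set) = CARD('a) ^ m"
  using bij_betw_same_card[OF bij_betw_coef_vectors, of m] by (simp add: card_PiE)

lemma coef_vectors_nonempty: "coef_vectors m \<noteq> {}"
  by (auto simp: coef_vectors_def)

text \<open>Every element of the larger span is \<open>u + scale_fun k v\<close> for exactly one
  pair: two representations with different \<open>k\<close> would put a nonzero multiple of
  \<open>v\<close>, hence \<open>v\<close> itself, into the old span.\<close>

lemma card_span_insert:
  fixes v :: "nat \<Rightarrow> 'a::{field,finite}"
  assumes "v \<notin> coef_space.span V"
  shows "card (coef_space.span (insert v V)) = CARD('a) * card (coef_space.span V)"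
proof -
  let ?h = "\<lambda>(k, u). u + scale_fun k v"
  have "inj_on ?h (UNIV \<times> coef_space.span V)"
  proof (rule inj_onI, clarify)
    fix k l and u w
    assume u: "u \<in> coef_space.span V" and w: "w \<in> coef_space.span V"
      and eq: "u + scale_fun k v = w + scale_fun l v"
    have "k = l"
    proof (rule ccontr)
      assume "k \<noteq> l"
      have "scale_fun (k - l) v = w - u"
        using eq by (simp add: coef_space.scale_left_diff_distrib algebra_simps)
      then have "scale_fun (inverse (k - l)) (scale_fun (k - l) v) \<in> coef_space.span V"
        using u w by (auto intro: coef_space.span_scale coef_space.span_diff)
      then show False
        using \<open>k \<noteq> l\<close> assms by simp
    qed
    with eq show "k = l \<and> u = w"
      by simp
  qed
  moreover have "coef_space.span (insert v V) = ?h ` (UNIV \<times> coef_space.span V)"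
  proof (intro equalityI subsetI)
    fix x assume "x \<in> coef_space.span (insert v V)"
    then obtain k where "x - scale_fun k v \<in> coef_space.span V"
      by (auto simp: coef_space.span_breakdown_eq)
    then show "x \<in> ?h ` (UNIV \<times> coef_space.span V)"
      by (intro image_eqI[where x = "(k, x - scale_fun k v)"]) auto
  next
    fix x assume "x \<in> ?h ` (UNIV \<times> coef_space.span V)"
    then obtain k u where "x = u + scale_fun k v" "u \<in> coef_space.span V"
      by auto
    then show "x \<in> coef_space.span (insert v V)"
      unfolding coef_space.span_breakdown_eq by (intro exI[of _ k]) simp
  qed
  ultimately show ?thesis
    by (simp add: card_image card_cartesian_product)
qed

text \<open>Recursion for the chance that k + 1 uniform vectors fill codimension d + 1: the first
  lies in the current span with probability \<open>1 / q ^ Suc d\<close>, and otherwise codimension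
  d remains.\<close>

lemma span_prob_step:
  fixes q :: real
  assumes "q > 0"
  shows "(\<Prod>j<Suc d. 1 - q ^ j / q ^ Suc k)
    = (\<Prod>j<Suc d. 1 - q ^ j / q ^ k) / q ^ Suc d + (1 - 1 / q ^ Suc d) * (\<Prod>j<d. 1 - q ^ j / q ^ k)"
proof -
  have "(\<Prod>j<Suc d. 1 - q ^ j / q ^ Suc k) = (1 - 1 / q ^ Suc k) * (\<Prod>j<d. 1 - q ^ j / q ^ k)"
    using assms by (subst prod.lessThan_Suc_shift) simp
  moreover have "1 - 1 / q ^ Suc k = (1 - q ^ d / q ^ k) / q ^ Suc d + (1 - 1 / q ^ Suc d)"
    using assms by (simp add: field_simps)
  ultimately show ?thesis
    by (simp add: algebra_simps)
qed

text \<open>Only the dimension r of the span reached so far matters, which makes a recursion over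
  the next vector possible. The product is the probability that the columns of a uniform k by (m -
  r) matrix are independent; it contains a factor 0 when k < m - r.\<close>

lemma word_sum_spans:
  fixes V :: "(nat \<Rightarrow> 'a::{field,finite}) set"
  defines "q \<equiv> real CARD('a)"
  assumes "V \<subseteq> coef_vectors m" "card (coef_space.span V) = CARD('a) ^ r"
  shows "word_sum (coef_vectors m) (\<lambda>_. 1 / q ^ m) k (\<lambda>vs. of_bool (spans m (V \<union> set vs)))
    = (\<Prod>j<m - r. 1 - q ^ j / q ^ k)"
  using assms(2,3)
proof (induction k arbitrary: V r)
  case (0 V r)
  have fin: "finite V"
    using finite_subset[OF "0"(1) finite_coef_vectors] .
  have sub: "coef_space.span V \<subseteq> coef_vectors m"
    by (rule coef_space.span_minimal[OF "0"(1) subspace_coef_vectors])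
  have q1: "CARD('a) > 1"
    using card_mono[of UNIV "{0, 1::'a}"] by simp
  have "spans m V \<longleftrightarrow> coef_space.span V = coef_vectors m"
    using sub by (auto simp: spans_iff_span[OF fin])
  also have "\<dots> \<longleftrightarrow> r = m"
    using sub "0"(2) q1 card_subset_eq[OF finite_coef_vectors sub]
    by (auto simp: card_coef_vectors)
  finally have iff: "spans m V \<longleftrightarrow> r = m" .
  have "CARD('a) ^ r \<le> CARD('a) ^ m"
    using card_mono[OF finite_coef_vectors sub] "0"(2) by (simp add: card_coef_vectors)
  then have "r \<le> m"
    using q1 by simp
  show ?case
  proof (cases "r = m")
    case False
    then obtain d where "m - r = Suc d"
      using \<open>r \<le> m\<close> by (metis Suc_diff_Suc le_neq_implies_less)
    \<comment> \<open>With no vectors left the factor at j = 0 is 1 - 1.\<close>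
    then show ?thesis
      using False by (simp add: iff prod.lessThan_Suc_shift del: prod.lessThan_Suc)
  qed (simp add: iff)
next
  case (Suc k V r)
  let ?S = "coef_space.span V" and ?C = "coef_vectors m :: (nat \<Rightarrow> 'a) set"
  let ?P = "\<lambda>r. \<Prod>j<m - r. 1 - q ^ j / q ^ k"
  let ?ws = "\<lambda>V. word_sum ?C (\<lambda>_. 1 / q ^ m) k (\<lambda>vs. of_bool (spans m (V \<union> set vs)))"
  have sub: "?S \<subseteq> ?C"
    by (rule coef_space.span_minimal[OF Suc.prems(1) subspace_coef_vectors])
  have q0: "q > 0"
    by (simp add: q_def)
  have eq: "V \<union> insert a X = insert a V \<union> X" for a X
    by auto
  have old: "?ws (insert a V) = ?P r" if "a \<in> ?S" for a
    using that sub Suc.prems by (intro Suc.IH) (auto simp: coef_space.span_redundant)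
  have new: "?ws (insert a V) = ?P (Suc r)" if "a \<in> ?C - ?S" for a
    using that sub Suc.prems by (intro Suc.IH) (auto simp: card_span_insert)
  have "word_sum ?C (\<lambda>_. 1 / q ^ m) (Suc k) (\<lambda>vs. of_bool (spans m (V \<union> set vs)))
      = (\<Sum>a\<in>?C. 1 / q ^ m * ?ws (insert a V))"
    by (simp add: eq)
  also have "\<dots> = (\<Sum>a\<in>?C - ?S. 1 / q ^ m * ?ws (insert a V)) + (\<Sum>a\<in>?S. 1 / q ^ m * ?ws (insert a V))"
    by (rule sum.subset_diff[OF sub finite_coef_vectors])
  also have "\<dots> = (q ^ m - q ^ r) / q ^ m * ?P (Suc r) + q ^ r / q ^ m * ?P r"
  proof -
    have "real (card (?C - ?S)) = q ^ m - q ^ r"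
      using card_mono[OF finite_coef_vectors sub] Suc.prems(2) finite_subset[OF sub finite_coef_vectors]
      by (simp add: card_Diff_subset[OF _ sub] card_coef_vectors of_nat_diff q_def)
    moreover have "real (card ?S) = q ^ r"
      using Suc.prems(2) by (simp add: q_def)
    ultimately show ?thesis
      by (simp add: old new del: Un_insert_left)
  qed
  also have "\<dots> = (\<Prod>j<m - r. 1 - q ^ j / q ^ Suc k)"
  proof (cases "r < m")
    case True
    then obtain d where d: "m = r + Suc d"
      using less_imp_Suc_add by auto
    then have dd: "m - r = Suc d" "m - Suc r = d"
      by auto
    have "q ^ r / q ^ m = 1 / q ^ Suc d" "(q ^ m - q ^ r) / q ^ m = 1 - 1 / q ^ Suc d"
      using q0 by (simp_all add: d power_add field_simps)
    then show ?thesis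
      using span_prob_step[OF q0, of k d] unfolding dd by simp
  next
    \<comment> \<open>The span already has at least q^m elements, so new directions carry weight 0
      and the product is empty.\<close>
    case False
    then have "q ^ r \<le> q ^ m"
      using card_mono[OF finite_coef_vectors sub] Suc.prems(2)
      by (simp add: card_coef_vectors q_def flip: of_nat_power)
    moreover have "q ^ r \<ge> q ^ m"
      using False by (intro power_increasing) (auto simp: q_def)
    ultimately show ?thesis
      using False q0 by simp
  qed
  finally show ?case .
qed

section \<open>Streams of independent letters\<close>

lemma pred_Stream:
  assumes "Measurable.pred (stream_space (measure_pmf p)) P"
  shows "Measurable.pred (stream_space (measure_pmf p)) (\<lambda>\<omega>. P (a ## \<omega>))"
  by (rule measurable_compose[OF _ assms]) simp

context
  fixes p :: "'b pmf" and A :: "'b set"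
  assumes finite_A: "finite A" and supp: "set_pmf p \<subseteq> A"
begin

interpretation strm: prob_space "stream_space (measure_pmf p)"
  by (rule prob_space.prob_space_stream_space[OF prob_space_measure_pmf])

text \<open>Stated for every measurable event and not just for prefix events, because
  \<open>decodable_within\<close> looks at the whole stream. The finite support turns the integral
  over the first letter into a sum.\<close>

lemma prob_stream_first_step:
  assumes "Measurable.pred (stream_space (measure_pmf p)) P"
  shows "strm.prob {\<omega>. P \<omega>} = (\<Sum>a\<in>A. pmf p a * strm.prob {\<omega>. P (a ## \<omega>)})"
proof -
  have "{\<omega>. P \<omega>} \<in> strm.events"
    using assms by (simp add: pred_def space_stream_space)
  then have "ennreal (strm.prob {\<omega>. P \<omega>}) = (\<integral>\<^sup>+a. strm.prob {\<omega>. P (a ## \<omega>)} \<partial>measure_pmf p)"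
    using prob_space.prob_stream_space[OF prob_space_measure_pmf[of p], of P] by (simp add: space_stream_space)
  also have "\<dots> = (\<Sum>a\<in>A. ennreal (strm.prob {\<omega>. P (a ## \<omega>)}) * ennreal (pmf p a))"
    using supp by (intro nn_integral_measure_pmf_support finite_A) (auto simp: set_pmf_eq)
  also have "\<dots> = ennreal (\<Sum>a\<in>A. pmf p a * strm.prob {\<omega>. P (a ## \<omega>)})"
    by (subst sum_ennreal[symmetric]) (auto simp: ennreal_mult mult.commute)
  finally show ?thesis
    by (subst (asm) ennreal_inj) (auto intro!: sum_nonneg)
qed

text \<open>For probability weights \<open>word_sum\<close> is an expectation over the first t
  letters. Measurability is asked of the composite predicate, since the prefix as a list need not be
  measurable.\<close>

lemma prob_stake:
  assumes "Measurable.pred (stream_space (measure_pmf p)) (\<lambda>\<omega>. Q (stake t \<omega>))"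
  shows "strm.prob {\<omega>. Q (stake t \<omega>)} = word_sum A (pmf p) t (\<lambda>xs. of_bool (Q xs))"
  using assms
proof (induction t arbitrary: Q)
  case 0
  then show ?case
    using strm.prob_space by (simp add: space_stream_space of_bool_def)
next
  case (Suc t)
  have "strm.prob {\<omega>. Q (stake (Suc t) \<omega>)} = (\<Sum>a\<in>A. pmf p a * strm.prob {\<omega>. Q (a # stake t \<omega>)})"
    using prob_stream_first_step[OF Suc.prems] by simp
  also have "\<dots> = (\<Sum>a\<in>A. pmf p a * word_sum A (pmf p) t (\<lambda>xs. of_bool (Q (a # xs))))"
    by (intro sum.cong refl arg_cong2[where f = "(*)"] Suc.IH) (use pred_Stream[OF Suc.prems] in simp)
  finally show ?case
    by simp
qed

end

text \<open>The tail-sum formula, by exchanging sum and integral. The weights used later are 1 for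
  E[N], 2k + 1 for E[N^2] and y^k / k! for E[S_N(y)].\<close>

lemma nn_integral_sum_lessThan:
  fixes N :: "'b \<Rightarrow> nat"
  assumes [measurable]: "N \<in> measurable M (count_space UNIV)" and c: "\<And>k. 0 \<le> c k"
  shows "(\<integral>\<^sup>+\<omega>. ennreal (\<Sum>k<N \<omega>. c k) \<partial>M) = (\<Sum>k. ennreal (c k) * emeasure M {\<omega>\<in>space M. k < N \<omega>})"
proof -
  have "ennreal (\<Sum>k<N \<omega>. c k) = (\<Sum>k. ennreal (c k) * indicator {\<omega>\<in>space M. k < N \<omega>} \<omega>)"
    if "\<omega> \<in> space M" for \<omega>
    using that c by (subst suminf_finite[of "{..<N \<omega>}"]) (auto simp: sum_ennreal)
  then have "(\<integral>\<^sup>+\<omega>. ennreal (\<Sum>k<N \<omega>. c k) \<partial>M)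
      = (\<integral>\<^sup>+\<omega>. (\<Sum>k. ennreal (c k) * indicator {\<omega>\<in>space M. k < N \<omega>} \<omega>) \<partial>M)"
    by (intro nn_integral_cong)
  also have "\<dots> = (\<Sum>k. \<integral>\<^sup>+\<omega>. ennreal (c k) * indicator {\<omega>\<in>space M. k < N \<omega>} \<omega> \<partial>M)"
    by (rule nn_integral_suminf) auto
  finally show ?thesis
    by (simp add: nn_integral_cmult_indicator)
qed

text \<open>Real-valued form for E[S_M(y)], where a summable weight over a finite measure makes the
  right side finite.\<close>

lemma integral_sum_lessThan:
  fixes N :: "'b \<Rightarrow> nat"
  assumes "finite_measure M" and [measurable]: "N \<in> measurable M (count_space UNIV)"
    and c: "\<And>k. 0 \<le> c k" "summable c"
  shows "(\<integral>\<omega>. (\<Sum>k<N \<omega>. c k) \<partial>M) = (\<Sum>k. c k * measure M {\<omega>\<in>space M. k < N \<omega>})"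
proof -
  interpret finite_measure M by fact
  have sums: "summable (\<lambda>k. c k * measure M {\<omega>\<in>space M. k < N \<omega>})"
  proof (rule summable_comparison_test')
    show "summable (\<lambda>k. c k * measure M (space M))"
      by (rule summable_mult2[OF c(2)])
    show "norm (c k * measure M {\<omega>\<in>space M. k < N \<omega>}) \<le> c k * measure M (space M)" for k
      using c(1) by (auto simp: abs_mult intro!: mult_left_mono finite_measure_mono)
  qed
  have "(\<integral>\<^sup>+\<omega>. ennreal (\<Sum>k<N \<omega>. c k) \<partial>M) = ennreal (\<Sum>k. c k * measure M {\<omega>\<in>space M. k < N \<omega>})"
    unfolding nn_integral_sum_lessThan[OF assms(2) c(1)] using c(1)
    by (simp add: emeasure_eq_measure ennreal_mult'[symmetric] suminf_ennreal2 sums)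
  moreover have "0 \<le> (\<Sum>k. c k * measure M {\<omega>\<in>space M. k < N \<omega>})"
    using c(1) by (intro suminf_nonneg sums) auto
  ultimately show ?thesis
    using c(1) by (subst integral_eq_nn_integral) (auto intro!: sum_nonneg)
qed

section \<open>Measurability of the decoding times\<close>

abbreviation rx_count :: "nat \<Rightarrow> nat \<Rightarrow> (nat \<times> 'b) stream \<Rightarrow> nat" where
  "rx_count i t \<omega> \<equiv> card {s. s < t \<and> fst (\<omega> !! s) = i}"

lemma rx_count_eq_sum: "rx_count i t \<omega> = (\<Sum>s<t. of_bool (fst (\<omega> !! s) = i))"
proof -
  have "{s. s < t \<and> fst (\<omega> !! s) = i} = {..<t} \<inter> {s. fst (\<omega> !! s) = i}"
    by auto
  then show ?thesis
    by (simp add: sum_of_bool_eq)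
qed

lemma rx_count_Suc_Stream: "rx_count i (Suc t) (a ## \<omega>) = of_bool (fst a = i) + rx_count i t \<omega>"
  unfolding rx_count_eq_sum sum.lessThan_Suc_shift by (simp only: snth_Stream snth.simps stream.sel)

lemma rx_count_mono: "t \<le> u \<Longrightarrow> rx_count i t \<omega> \<le> rx_count i u \<omega>"
  by (intro card_mono) auto

lemma received_eq_image: "received i t \<omega> = (\<lambda>s. snd (\<omega> !! s)) ` {s. s < t \<and> fst (\<omega> !! s) = i}"
  by (auto simp: received_def)

lemma finite_received: "finite (received i t \<omega>)"
  by (simp add: received_eq_image)

lemma received_mono: "t \<le> u \<Longrightarrow> received i t \<omega> \<subseteq> received i u \<omega>"
  unfolding received_eq_image by (intro image_mono) auto

lemma received_0 [simp]: "received i 0 \<omega> = {}"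
  by (simp add: received_def)

lemma received_Suc:
  "received i (Suc t) \<omega> = (if fst (\<omega> !! t) = i then insert (snd (\<omega> !! t)) else id) (received i t \<omega>)"
proof -
  have "{s. s < Suc t \<and> fst (\<omega> !! s) = i}
      = (if fst (\<omega> !! t) = i then {t} else {}) \<union> {s. s < t \<and> fst (\<omega> !! s) = i}"
    by (auto simp: less_Suc_eq)
  then show ?thesis
    unfolding received_eq_image by (simp add: image_image image_Un)
qed

lemma received_Suc_Stream:
  "received i (Suc t) (a ## \<omega>) = (if fst a = i then insert (snd a) else id) (received i t \<omega>)"
proof -
  have "{s. s < Suc t \<and> fst ((a ## \<omega>) !! s) = i}
      = (if fst a = i then {0} else {}) \<union> Suc ` {s. s < t \<and> fst (\<omega> !! s) = i}"
    by (auto simp: less_Suc_eq_0_disj)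
  then show ?thesis
    unfolding received_eq_image by (simp add: image_image image_Un)
qed

lemma received_eq_stake: "received i t \<omega> = snd ` set (filter (\<lambda>a. fst a = i) (stake t \<omega>))"
proof (induction t arbitrary: \<omega>)
  case (Suc t)
  have "received i (Suc t) (shd \<omega> ## stl \<omega>)
      = snd ` set (filter (\<lambda>a. fst a = i) (stake (Suc t) (shd \<omega> ## stl \<omega>)))"
    unfolding received_Suc_Stream Suc.IH by simp
  then show ?case
    by (simp only: stream.collapse)
qed simp

lemma spans_mono:
  assumes "spans m V" "V \<subseteq> V'" "finite V'"
  shows "spans m V'"
  using assms coef_space.span_mono[of V V'] by (auto simp: spans_iff_span finite_subset)

lemma decodable_mono: "decodable g i t \<omega> \<Longrightarrow> t \<le> u \<Longrightarrow> decodable g i u \<omega>"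
  unfolding decodable_def by (rule spans_mono[OF _ received_mono finite_received])

text \<open>Almost surely M \<le> k is the event below with empty U. The initial set U makes
  a first-step analysis on the stream possible.\<close>

definition decodable_within :: "(nat \<Rightarrow> nat) \<Rightarrow> nat \<Rightarrow> (nat \<Rightarrow> 'a::field) set \<Rightarrow> nat \<Rightarrow> (nat \<times> (nat \<Rightarrow> 'a)) stream \<Rightarrow> bool" where
  "decodable_within g i U k \<omega> \<longleftrightarrow> (\<exists>t. spans (g i) (U \<union> received i t \<omega>) \<and> rx_count i t \<omega> \<le> k)"

context
  fixes p :: "(nat \<times> (nat \<Rightarrow> 'a::{field,finite})) pmf"
begin

lemma measurable_sent [measurable]: "(\<lambda>\<omega>. f (\<omega> !! t)) \<in> measurable (stream_space (measure_pmf p)) (count_space UNIV)"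
  by (rule measurable_compose[OF measurable_snth]) simp

text \<open>The alphabet is uncountable, so prefixes of the stream are not measurable as lists.
  Membership of a random vector w in the received span is reduced, packet by packet, to
  finitely many scalars and the coordinates of w; w has to vary for the induction.\<close>

lemma pred_in_span_received:
  assumes "\<And>j. (\<lambda>\<omega>. w \<omega> j) \<in> measurable (stream_space (measure_pmf p)) (count_space UNIV)"
  shows "Measurable.pred (stream_space (measure_pmf p)) (\<lambda>\<omega>. w \<omega> \<in> coef_space.span (received i t \<omega>))"
  using assms
proof (induction t arbitrary: w)
  case (0 w)
  note [measurable] = 0
  have "Measurable.pred (stream_space (measure_pmf p)) (\<lambda>\<omega>. \<forall>j. w \<omega> j = 0)"
    by measurable
  then show ?case
    by (simp add: fun_eq_iff)
next
  case (Suc t w)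
  note [measurable] = Suc.prems
  have [measurable]: "Measurable.pred (stream_space (measure_pmf p))
      (\<lambda>\<omega>. w \<omega> - scale_fun k (snd (\<omega> !! t)) \<in> coef_space.span (received i t \<omega>))" for k
    by (rule Suc.IH) (simp add: scale_fun_def)
  have [measurable]: "Measurable.pred (stream_space (measure_pmf p)) (\<lambda>\<omega>. w \<omega> \<in> coef_space.span (received i t \<omega>))"
    by (rule Suc.IH) fact
  have "Measurable.pred (stream_space (measure_pmf p)) (\<lambda>\<omega>. if fst (\<omega> !! t) = i
      then \<exists>k. w \<omega> - scale_fun k (snd (\<omega> !! t)) \<in> coef_space.span (received i t \<omega>)
      else w \<omega> \<in> coef_space.span (received i t \<omega>))"
    by measurable
  also have "(\<lambda>\<omega>. if fst (\<omega> !! t) = i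
      then \<exists>k. w \<omega> - scale_fun k (snd (\<omega> !! t)) \<in> coef_space.span (received i t \<omega>)
      else w \<omega> \<in> coef_space.span (received i t \<omega>))
    = (\<lambda>\<omega>. w \<omega> \<in> coef_space.span (received i (Suc t) \<omega>))"
    by (simp add: fun_eq_iff received_Suc coef_space.span_breakdown_eq)
  finally show ?case .
qed

text \<open>Over a finite field, spanning is a finite conjunction of memberships, one for each
  target vector.\<close>

lemma pred_decodable [measurable]: "Measurable.pred (stream_space (measure_pmf p)) (decodable g i t)"
proof -
  have "Measurable.pred (stream_space (measure_pmf p)) (\<lambda>\<omega>. \<forall>w\<in>coef_vectors (g i). w \<in> coef_space.span (received i t \<omega>))"
    by (intro pred_intros_finite finite_coef_vectors pred_in_span_received) simp
  then show ?thesis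
    by (simp add: decodable_def[abs_def] spans_iff_span finite_received subset_iff Ball_def)
qed

lemma measurable_rx_count [measurable]:
  "(\<lambda>\<omega>. rx_count i t \<omega>) \<in> measurable (stream_space (measure_pmf p)) (count_space UNIV)"
  unfolding rx_count_eq_sum by measurable

lemma measurable_W_total [measurable]: "W_total n g \<in> measurable (stream_space (measure_pmf p)) (count_space UNIV)"
  unfolding W_total_def[abs_def] by measurable

lemma measurable_M_count [measurable]: "M_count g i \<in> measurable (stream_space (measure_pmf p)) (count_space UNIV)"
proof -
  have "decode_time g i \<in> measurable (stream_space (measure_pmf p)) (count_space UNIV)"
    unfolding decode_time_def[abs_def] by measurable
  then show ?thesis
    unfolding M_count_def[abs_def] by (rule measurable_compose_countable[rotated]) measurable
qed

text \<open>The starting point for the first-step analysis; for larger initial sets measurability is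
  inherited by fixing a first packet of the stream.\<close>

lemma pred_decodable_within: "Measurable.pred (stream_space (measure_pmf p)) (decodable_within g i {} k)"
  unfolding decodable_within_def[abs_def] using pred_decodable unfolding decodable_def[abs_def] by simp

end

lemma decodable_within_0: "decodable_within g i U 0 \<omega> \<longleftrightarrow> spans (g i) U"
proof
  assume "decodable_within g i U 0 \<omega>"
  then obtain t where t: "spans (g i) (U \<union> received i t \<omega>)" "rx_count i t \<omega> = 0"
    by (auto simp: decodable_within_def)
  then have "{s. s < t \<and> fst (\<omega> !! s) = i} = {}"
    by simp
  then have "received i t \<omega> = {}"
    unfolding received_eq_image by (simp only: image_empty)
  with t show "spans (g i) U"
    by simp
qed (auto simp: decodable_within_def intro!: exI[of _ 0])

lemma decodable_within_hit:
  assumes "finite U"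
  shows "decodable_within g i U (Suc k) ((i, v) ## \<omega>) \<longleftrightarrow> decodable_within g i (insert v U) k \<omega>"
proof
  assume "decodable_within g i U (Suc k) ((i, v) ## \<omega>)"
  then obtain t where t: "spans (g i) (U \<union> received i t ((i, v) ## \<omega>))" "rx_count i t ((i, v) ## \<omega>) \<le> Suc k"
    by (auto simp: decodable_within_def)
  show "decodable_within g i (insert v U) k \<omega>"
  proof (cases t)
    \<comment> \<open>At time 0 nothing has been received, so \<open>U\<close> alone spans and
      enlarging it is harmless.\<close>
    case 0
    then have "spans (g i) (insert v U)"
      using t(1) spans_mono assms by (metis Un_empty_right finite_insert received_0 subset_insertI)
    then show ?thesis
      by (auto simp: decodable_within_def intro!: exI[of _ 0])
  next
    case (Suc u)
    then show ?thesis
      using t by (auto simp: decodable_within_def received_Suc_Stream rx_count_Suc_Stream intro!: exI[of _ u])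
  qed
next
  assume "decodable_within g i (insert v U) k \<omega>"
  then obtain t where "spans (g i) (insert v U \<union> received i t \<omega>)" "rx_count i t \<omega> \<le> k"
    by (auto simp: decodable_within_def)
  then show "decodable_within g i U (Suc k) ((i, v) ## \<omega>)"
    unfolding decodable_within_def
    by (intro exI[of _ "Suc t"]) (auto simp: received_Suc_Stream rx_count_Suc_Stream)
qed

lemma decodable_within_miss:
  assumes "l \<noteq> i"
  shows "decodable_within g i U k ((l, v) ## \<omega>) \<longleftrightarrow> decodable_within g i U k \<omega>"
proof
  assume "decodable_within g i U k ((l, v) ## \<omega>)"
  then obtain t where t: "spans (g i) (U \<union> received i t ((l, v) ## \<omega>))" "rx_count i t ((l, v) ## \<omega>) \<le> k"
    by (auto simp: decodable_within_def)
  show "decodable_within g i U k \<omega>"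
  proof (cases t)
    case 0
    then show ?thesis
      using t by (auto simp: decodable_within_def intro!: exI[of _ 0])
  next
    case (Suc u)
    then show ?thesis
      using t assms by (auto simp: decodable_within_def received_Suc_Stream rx_count_Suc_Stream intro!: exI[of _ u])
  qed
next
  assume "decodable_within g i U k \<omega>"
  then obtain t where "spans (g i) (U \<union> received i t \<omega>)" "rx_count i t \<omega> \<le> k"
    by (auto simp: decodable_within_def)
  then show "decodable_within g i U k ((l, v) ## \<omega>)"
    unfolding decodable_within_def using assms
    by (intro exI[of _ "Suc t"]) (auto simp: received_Suc_Stream rx_count_Suc_Stream)
qed

section \<open>The law of the decoding times\<close>

locale generation_channel =
  fixes n :: nat and g :: "nat \<Rightarrow> nat" and \<rho> :: "nat \<Rightarrow> real"
    and \<Omega> :: "(nat \<times> (nat \<Rightarrow> 'a::{field,finite})) stream measure"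
  assumes \<rho>_pos: "\<And>i. i < n \<Longrightarrow> \<rho> i > 0"
    and \<rho>_sum: "(\<Sum>i<n. \<rho> i) = 1"
    and \<Omega>_eq: "\<Omega> = channel n \<rho> g"
begin

definition tx :: "(nat \<times> (nat \<Rightarrow> 'a)) pmf" where
  "tx = tx_pmf n \<rho> g"

definition q :: real where
  "q = real CARD('a)"

text \<open>The letter type is infinite; for finite \<open>I\<close> this set is finite, and over
  all generations it contains the support of the channel, so sums over letters can run over
  it.\<close>

definition packets :: "nat set \<Rightarrow> (nat \<times> (nat \<Rightarrow> 'a)) set" where
  "packets I = (SIGMA i:I. coef_vectors (g i))"

definition span_prob :: "nat \<Rightarrow> nat \<Rightarrow> real" where
  "span_prob i k = (\<Prod>j<g i. 1 - q ^ j / q ^ k)"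

lemma q_gt_1: "q > 1"
  using card_mono[of UNIV "{0, 1::'a}"] by (simp add: q_def)

lemma \<Omega>_stream: "\<Omega> = stream_space (measure_pmf tx)"
  by (simp add: \<Omega>_eq channel_def tx_def)

sublocale prob_space \<Omega>
  unfolding \<Omega>_stream by (rule prob_space.prob_space_stream_space[OF prob_space_measure_pmf])

lemma space_\<Omega> [simp]: "space \<Omega> = UNIV"
  by (simp add: \<Omega>_stream space_stream_space)

lemma pmf_gen: "pmf (gen_pmf n \<rho>) i = (if i < n then \<rho> i else 0)"
  unfolding gen_pmf_def
proof (rule pmf_embed_pmf)
  show "0 \<le> (if i < n then \<rho> i else 0)" for i
    using \<rho>_pos by (simp add: less_imp_le)
  have "(\<integral>\<^sup>+i. ennreal (if i < n then \<rho> i else 0) \<partial>count_space UNIV)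
      = (\<Sum>i<n. ennreal (if i < n then \<rho> i else 0))"
    by (rule nn_integral_count_space') auto
  also have "\<dots> = (\<Sum>i<n. ennreal (\<rho> i))"
    by simp
  also have "\<dots> = 1"
    using \<rho>_pos \<rho>_sum by (subst sum_ennreal) (auto simp: less_imp_le)
  finally show "(\<integral>\<^sup>+i. ennreal (if i < n then \<rho> i else 0) \<partial>count_space UNIV) = 1" .
qed

lemma set_pmf_tx: "set_pmf tx \<subseteq> packets {..<n}"
  by (auto simp: tx_def tx_pmf_def packets_def set_pmf_of_set[OF coef_vectors_nonempty finite_coef_vectors]
    set_pmf_eq[of "gen_pmf n \<rho>"] pmf_gen split: if_splits)

lemma pmf_tx:
  assumes "i < n" "v \<in> coef_vectors (g i)"
  shows "pmf tx (i, v) = \<rho> i * (1 / q ^ g i)"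
proof -
  let ?U = "\<lambda>l. pmf_of_set (coef_vectors (g l) :: (nat \<Rightarrow> 'a) set)"
  have "pmf tx (i, v) = (\<integral>l. pmf (map_pmf (\<lambda>v. (l, v)) (?U l)) (i, v) \<partial>measure_pmf (gen_pmf n \<rho>))"
    by (simp add: tx_def tx_pmf_def pmf_bind)
  also have "\<dots> = (\<Sum>l\<in>{i}. pmf (map_pmf (\<lambda>v. (l, v)) (?U l)) (i, v) * pmf (gen_pmf n \<rho>) l)"
  proof (rule integral_measure_pmf_real)
    fix l assume "pmf (map_pmf (\<lambda>v. (l, v)) (?U l)) (i, v) \<noteq> 0"
    then show "l \<in> {i}"
      using pmf_map_outside[of "(i, v)" "\<lambda>v. (l, v)" "?U l"] by auto
  qed simp
  also have "pmf (map_pmf (\<lambda>v. (i, v)) (?U i)) (i, v) = pmf (?U i) v"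
    by (rule pmf_map_inj') (auto intro: injI)
  then have "(\<Sum>l\<in>{i}. pmf (map_pmf (\<lambda>v. (l, v)) (?U l)) (i, v) * pmf (gen_pmf n \<rho>) l) = \<rho> i * (1 / q ^ g i)"
    using assms by (simp add: pmf_gen coef_vectors_nonempty finite_coef_vectors card_coef_vectors q_def)
  finally show ?thesis .
qed

lemma finite_packets: "finite I \<Longrightarrow> finite (packets I)"
  by (simp add: packets_def finite_coef_vectors)

text \<open>Let x be the probability on the left. A packet of another generation leaves the event
  unchanged, so conditioning on the first packet gives x = rho_i y + (1 - rho_i) x, where y averages
  over the first vector of generation i. As rho_i > 0, x = y: the interleaved traffic drops out and
  only uniform vectors of one generation remain.\<close>

lemma prob_decodable_within_span:
  assumes "i < n" "U \<subseteq> coef_vectors (g i)" "Measurable.pred \<Omega> (decodable_within g i U k)"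
  shows "prob {\<omega>. decodable_within g i U k \<omega>}
    = word_sum (coef_vectors (g i)) (\<lambda>_. 1 / q ^ g i) k (\<lambda>vs. of_bool (spans (g i) (U \<union> set vs)))"
  using assms(2,3)
proof (induction k arbitrary: U)
  case (0 U)
  show ?case
    using prob_space by (simp add: decodable_within_0)
next
  case (Suc k U)
  let ?C = "coef_vectors (g i) :: (nat \<Rightarrow> 'a) set"
  let ?E = "\<lambda>U k. {\<omega>. decodable_within g i U k \<omega>}"
  let ?x = "prob (?E U (Suc k))"
  let ?y = "\<Sum>v\<in>?C. 1 / q ^ g i * prob (?E (insert v U) k)"
  have fin: "finite U"
    using finite_subset[OF Suc.prems(1) finite_coef_vectors] .
  have "?x = (\<Sum>a\<in>packets {..<n}. pmf tx a * prob {\<omega>. decodable_within g i U (Suc k) (a ## \<omega>)})"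
    using Suc.prems(2) unfolding \<Omega>_stream
    by (intro prob_stream_first_step finite_packets set_pmf_tx) simp_all
  also have "\<dots> = (\<Sum>(l, v)\<in>packets {..<n}. pmf tx (l, v) * (if l = i then prob (?E (insert v U) k) else ?x))"
    by (intro sum.cong) (auto simp: decodable_within_hit[OF fin] decodable_within_miss)
  also have "\<dots> = (\<Sum>l<n. \<Sum>v\<in>coef_vectors (g l). pmf tx (l, v) * (if l = i then prob (?E (insert v U) k) else ?x))"
    unfolding packets_def by (rule sum.Sigma[symmetric]) (auto simp: finite_coef_vectors)
  also have "\<dots> = (\<Sum>l<n. \<rho> l * (if l = i then ?y else ?x))"
  proof (intro sum.cong refl)
    fix l assume "l \<in> {..<n}"
    then have "(\<Sum>v\<in>coef_vectors (g l). pmf tx (l, v) * (if l = i then prob (?E (insert v U) k) else ?x))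
      = \<rho> l * (\<Sum>v\<in>coef_vectors (g l). 1 / q ^ g l * (if l = i then prob (?E (insert v U) k) else ?x))"
      unfolding sum_distrib_left by (intro sum.cong) (simp_all add: pmf_tx)
    also have "(\<Sum>v\<in>coef_vectors (g l). 1 / q ^ g l * (if l = i then prob (?E (insert v U) k) else ?x))
        = (if l = i then ?y else ?x)"
      using q_gt_1 by (simp add: card_coef_vectors flip: q_def)
    finally show "(\<Sum>v\<in>coef_vectors (g l). pmf tx (l, v) * (if l = i then prob (?E (insert v U) k) else ?x))
      = \<rho> l * (if l = i then ?y else ?x)" .
  qed
  also have "\<dots> = \<rho> i * ?y + (1 - \<rho> i) * ?x"
  proof -
    have "(\<Sum>l\<in>{..<n} - {i}. \<rho> l) = 1 - \<rho> i"
      using \<rho>_sum assms(1) by (simp add: sum_diff1)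
    then show ?thesis
      using assms(1) by (subst sum.remove[of _ i]) (auto simp flip: sum_distrib_right)
  qed
  finally have "?x = ?y"
    using \<rho>_pos[OF assms(1)] by (simp add: algebra_simps)
  also have "\<dots> = (\<Sum>v\<in>?C. 1 / q ^ g i *
      word_sum ?C (\<lambda>_. 1 / q ^ g i) k (\<lambda>vs. of_bool (spans (g i) (insert v U \<union> set vs))))"
  proof (intro sum.cong refl arg_cong2[where f = "(*)"] Suc.IH)
    fix v assume "v \<in> ?C"
    with Suc.prems show "insert v U \<subseteq> ?C"
      by simp
    \<comment> \<open>Measurability passes from \<open>U\<close> to \<open>insert v U\<close> by
      prefixing the packet \<open>(i, v)\<close>.\<close>
    have "Measurable.pred \<Omega> (\<lambda>\<omega>. decodable_within g i U (Suc k) ((i, v) ## \<omega>))"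
      using Suc.prems(2) unfolding \<Omega>_stream by (rule pred_Stream)
    then show "Measurable.pred \<Omega> (decodable_within g i (insert v U) k)"
      by (simp add: decodable_within_hit[OF fin])
  qed
  finally show ?case
    by simp
qed

lemma prob_decodable_within:
  assumes "i < n"
  shows "prob {\<omega>. decodable_within g i {} k \<omega>} = span_prob i k"
proof -
  let ?C = "coef_vectors (g i) :: (nat \<Rightarrow> 'a) set"
  have "prob {\<omega>. decodable_within g i {} k \<omega>}
      = word_sum ?C (\<lambda>_. 1 / q ^ g i) k (\<lambda>vs. of_bool (spans (g i) ({} \<union> set vs)))"
    using assms by (intro prob_decodable_within_span) (simp_all add: \<Omega>_stream pred_decodable_within)
  also have "\<dots> = span_prob i k"
    unfolding q_def by (subst word_sum_spans[where r = 0]) (auto simp: span_prob_def q_def)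
  finally show ?thesis .
qed

text \<open>Read off from the probabilistic meaning; the product formula hides these bounds, as it
  has negative factors when k + 1 < \<open>g i\<close>.\<close>

lemma span_prob_nonneg: "i < n \<Longrightarrow> 0 \<le> span_prob i k" and span_prob_le_1: "i < n \<Longrightarrow> span_prob i k \<le> 1"
  by (simp_all flip: prob_decodable_within)

lemma span_prob_tendsto_1: "span_prob i \<longlonglongrightarrow> 1"
proof -
  have "(\<lambda>k. \<Prod>j<g i. 1 - q ^ j / q ^ k) \<longlonglongrightarrow> (\<Prod>j<g i. 1 - 0)"
  proof (intro tendsto_prod tendsto_diff tendsto_const)
    fix j
    have "(\<lambda>k. q ^ j * (1 / q) ^ k) \<longlonglongrightarrow> q ^ j * 0"
      using q_gt_1 by (intro tendsto_mult tendsto_const LIMSEQ_power_zero) simp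
    then show "(\<lambda>k. q ^ j / q ^ k) \<longlonglongrightarrow> 0"
      by (simp add: power_divide)
  qed
  then show ?thesis
    by (simp add: span_prob_def[abs_def])
qed

text \<open>Decoding within k packets of the generation implies decoding at some time, and its
  probability tends to 1 as k grows.\<close>

lemma AE_decodable:
  assumes "i < n"
  shows "AE \<omega> in \<Omega>. \<exists>t. decodable g i t \<omega>"
proof -
  have [measurable]: "Measurable.pred \<Omega> (decodable g i t)" for t
    unfolding \<Omega>_stream by (rule pred_decodable)
  have "span_prob i k \<le> prob {\<omega>. \<exists>t. decodable g i t \<omega>}" for k
  proof -
    have "{\<omega> \<in> space \<Omega>. \<exists>t. decodable g i t \<omega>} \<in> events"
      by measurable
    then show ?thesis
      unfolding prob_decodable_within[OF assms, symmetric]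
      by (intro finite_measure_mono) (auto simp: decodable_within_def decodable_def)
  qed
  then have "1 \<le> prob {\<omega>. \<exists>t. decodable g i t \<omega>}"
    by (intro LIMSEQ_le_const2[OF span_prob_tendsto_1]) auto
  then have "prob {\<omega>. \<exists>t. decodable g i t \<omega>} = 1"
    by (simp add: antisym)
  moreover have "{\<omega>\<in>space \<Omega>. \<exists>t. decodable g i t \<omega>} \<in> events"
    by measurable
  ultimately show ?thesis
    using prob_eq_1[of "{\<omega>. \<exists>t. decodable g i t \<omega>}"] by simp
qed

lemma prob_M_count_greater:
  assumes "i < n"
  shows "prob {\<omega>. k < M_count g i \<omega>} = 1 - span_prob i k"
proof -
  have [measurable]: "M_count g i \<in> measurable \<Omega> (count_space UNIV)" "Measurable.pred \<Omega> (decodable_within g i {} k)"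
    unfolding \<Omega>_stream by (rule measurable_M_count pred_decodable_within)+
  have "{\<omega>\<in>space \<Omega>. M_count g i \<omega> \<le> k} \<in> events" "{\<omega>\<in>space \<Omega>. decodable_within g i {} k \<omega>} \<in> events"
    by measurable
  then have ev: "{\<omega>. M_count g i \<omega> \<le> k} \<in> events" "{\<omega>. decodable_within g i {} k \<omega>} \<in> events"
    by simp_all
  \<comment> \<open>\<open>decode_time\<close> is a LEAST, hence unspecified where no time works;
    the equivalence is therefore confined to the almost sure event.\<close>
  have "M_count g i \<omega> \<le> k \<longleftrightarrow> decodable_within g i {} k \<omega>" if ex: "\<exists>t. decodable g i t \<omega>" for \<omega>
  proof
    assume "M_count g i \<omega> \<le> k"
    then show "decodable_within g i {} k \<omega>"
      using LeastI_ex[OF ex]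
      by (auto simp: decodable_within_def M_count_def decode_time_def decodable_def)
  next
    assume "decodable_within g i {} k \<omega>"
    then obtain t where t: "decodable g i t \<omega>" "rx_count i t \<omega> \<le> k"
      by (auto simp: decodable_within_def decodable_def)
    have "M_count g i \<omega> \<le> rx_count i t \<omega>"
      unfolding M_count_def decode_time_def by (rule rx_count_mono[OF Least_le[of _ t]]) fact
    with t show "M_count g i \<omega> \<le> k"
      by simp
  qed
  then have "AE \<omega> in \<Omega>. \<omega> \<in> {\<omega>. M_count g i \<omega> \<le> k} \<longleftrightarrow> \<omega> \<in> {\<omega>. decodable_within g i {} k \<omega>}"
    using AE_decodable[OF assms] by auto
  then have pr: "prob {\<omega>. M_count g i \<omega> \<le> k} = span_prob i k"
    using finite_measure_eq_AE[OF _ ev] by (simp add: prob_decodable_within assms)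
  have compl: "UNIV - {\<omega>. M_count g i \<omega> \<le> k} = {\<omega>. k < M_count g i \<omega>}"
    by auto
  show ?thesis
    using prob_compl[OF ev(1)] unfolding space_\<Omega> compl pr .
qed

section \<open>The total time W and the product formula for its generating function\<close>

definition all_span :: "nat set \<Rightarrow> (nat \<times> (nat \<Rightarrow> 'a)) list \<Rightarrow> real" where
  "all_span I xs = (\<Prod>i\<in>I. of_bool (spans (g i) (snd ` set (filter (\<lambda>a. fst a = i) xs))))"

definition success_prob :: "nat \<Rightarrow> real" where
  "success_prob t = word_sum (packets {..<n}) (pmf tx) t (all_span {..<n})"

lemma prob_all_decodable: "prob {\<omega>. \<forall>i<n. decodable g i t \<omega>} = success_prob t"
proof -
  let ?Q = "\<lambda>xs. \<forall>i<n. spans (g i) (snd ` set (filter (\<lambda>a. fst a = i) xs))"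
  have [measurable]: "Measurable.pred (stream_space (measure_pmf tx)) (\<lambda>\<omega>. decodable g i t \<omega>)" for i
    by (rule pred_decodable)
  have eq: "?Q (stake t \<omega>) \<longleftrightarrow> (\<forall>i<n. decodable g i t \<omega>)" for \<omega>
    by (simp add: decodable_def received_eq_stake)
  have "prob {\<omega>. ?Q (stake t \<omega>)} = word_sum (packets {..<n}) (pmf tx) t (\<lambda>xs. of_bool (?Q xs))"
    unfolding \<Omega>_stream
    by (rule prob_stake[OF finite_packets set_pmf_tx]) (simp_all only: eq finite_lessThan, measurable)
  also have "(\<lambda>xs. of_bool (?Q xs)) = all_span {..<n}"
  proof
    fix xs
    show "of_bool (?Q xs) = all_span {..<n} xs"
    proof (cases "?Q xs")
      case False
      then show ?thesis
        by (auto simp: all_span_def intro!: prod_zero[symmetric])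
    qed (simp add: all_span_def)
  qed
  finally show ?thesis
    by (simp only: eq success_prob_def)
qed

lemma prob_W_total_greater: "prob {\<omega>. t < W_total n g \<omega>} = 1 - success_prob t"
proof -
  have [measurable]: "W_total n g \<in> measurable \<Omega> (count_space UNIV)"
      "\<And>i. Measurable.pred \<Omega> (\<lambda>\<omega>. decodable g i t \<omega>)"
    unfolding \<Omega>_stream by (rule measurable_W_total pred_decodable)+
  have "{\<omega>\<in>space \<Omega>. W_total n g \<omega> \<le> t} \<in> events" "{\<omega>\<in>space \<Omega>. \<forall>i<n. decodable g i t \<omega>} \<in> events"
    by measurable
  then have ev: "{\<omega>. W_total n g \<omega> \<le> t} \<in> events" "{\<omega>. \<forall>i<n. decodable g i t \<omega>} \<in> events"
    by simp_all
  have iff: "W_total n g \<omega> \<le> t \<longleftrightarrow> (\<forall>i<n. decodable g i t \<omega>)"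
    if ex: "\<forall>i<n. \<exists>t. decodable g i t \<omega>" for \<omega>
  proof -
    obtain T where T: "\<forall>i<n. decodable g i (T i) \<omega>"
      using ex by metis
    \<comment> \<open>Decodability is monotone in time, so any common upper bound of the
      \<open>T i\<close> serves; their sum is one.\<close>
    have "decodable g i (\<Sum>l<n. T l) \<omega>" if "i < n" for i
      by (rule decodable_mono[OF T[rule_format, OF that]]) (use that in \<open>auto intro: member_le_sum\<close>)
    then have dec: "\<forall>i<n. decodable g i (W_total n g \<omega>) \<omega>"
      unfolding W_total_def by (intro LeastI[of "\<lambda>t. \<forall>i<n. decodable g i t \<omega>" "\<Sum>l<n. T l"]) simp
    show ?thesis
    proof
      assume "W_total n g \<omega> \<le> t"
      with dec show "\<forall>i<n. decodable g i t \<omega>"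
        using decodable_mono[of g _ "W_total n g \<omega>" \<omega> t] by simp
    next
      assume "\<forall>i<n. decodable g i t \<omega>"
      then show "W_total n g \<omega> \<le> t"
        unfolding W_total_def by (rule Least_le)
    qed
  qed
  have "AE \<omega> in \<Omega>. \<forall>i<n. \<exists>t. decodable g i t \<omega>"
    using AE_decodable by (auto simp: AE_all_countable)
  then have "AE \<omega> in \<Omega>. \<omega> \<in> {\<omega>. W_total n g \<omega> \<le> t} \<longleftrightarrow> \<omega> \<in> {\<omega>. \<forall>i<n. decodable g i t \<omega>}"
    by eventually_elim (simp add: iff)
  then have pr: "prob {\<omega>. W_total n g \<omega> \<le> t} = success_prob t"
    using finite_measure_eq_AE[OF _ ev] by (simp add: prob_all_decodable)
  have compl: "UNIV - {\<omega>. W_total n g \<omega> \<le> t} = {\<omega>. t < W_total n g \<omega>}"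
    by auto
  show ?thesis
    using prob_compl[OF ev(1)] unfolding space_\<Omega> compl pr .
qed

text \<open>The letters of generation i carry total weight rho_i; pulling this factor out of each of
  the t letters rescales the argument of the generating function.\<close>

lemma egf_word_sum_single:
  assumes "i < n"
  shows "egf (\<lambda>t. word_sum (packets {i}) (pmf tx) t (all_span {i})) x = egf (span_prob i) (\<rho> i * x)"
proof -
  let ?C = "coef_vectors (g i) :: (nat \<Rightarrow> 'a) set"
  have p: "packets {i} = Pair i ` coef_vectors (g i)"
    by (auto simp: packets_def)
  have "word_sum (packets {i}) (pmf tx) t (all_span {i}) = \<rho> i ^ t * span_prob i t" for t
  proof -
    have "word_sum (packets {i}) (pmf tx) t (all_span {i})
        = word_sum ?C (\<lambda>v. pmf tx (i, v)) t (\<lambda>vs. all_span {i} (map (Pair i) vs))"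
      unfolding p by (rule word_sum_image) (auto intro: inj_onI)
    also have "\<dots> = word_sum ?C (\<lambda>_. \<rho> i * (1 / q ^ g i)) t
        (\<lambda>vs. of_bool (spans (g i) ({} \<union> set vs)))"
      by (rule word_sum_cong) (auto simp: pmf_tx assms all_span_def image_image filter_map o_def)
    also have "\<dots> = \<rho> i ^ t * word_sum ?C (\<lambda>_. 1 / q ^ g i) t
        (\<lambda>vs. of_bool (spans (g i) ({} \<union> set vs)))"
      by (rule word_sum_scale)
    also have "word_sum ?C (\<lambda>_. 1 / q ^ g i) t
        (\<lambda>vs. of_bool (spans (g i) ({} \<union> set vs)))  = span_prob i t"
      unfolding q_def by (subst word_sum_spans[where r = 0]) (auto simp: span_prob_def q_def)
    finally show ?thesis .
  qed
  then show ?thesis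
    by (simp add: egf_scale)
qed

lemma abs_all_span_le: "\<bar>all_span I xs\<bar> \<le> 1"
  unfolding all_span_def abs_prod by (intro prod_le_1) auto

text \<open>One generation is split off at a time. \<open>all_span\<close> is a real-valued product
  of indicators, so it factors over generations, and each factor sees only its own letters: this is
  the form that \<open>egf_word_sum_union\<close> asks for.\<close>

lemma egf_word_sum_packets:
  assumes "finite I" "I \<subseteq> {..<n}"
  shows "egf (\<lambda>t. word_sum (packets I) (pmf tx) t (all_span I)) x = (\<Prod>i\<in>I. egf (span_prob i) (\<rho> i * x))"
  using assms
proof (induction I rule: finite_induct)
  case empty
  show ?case
    by (simp add: packets_def word_sum_empty egf_delta all_span_def)
next
  case (insert i I)
  let ?A = "packets {i}" and ?B = "packets I"
  have un: "packets (insert i I) = ?A \<union> ?B" and disj: "?A \<inter> ?B = {}"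
    using insert.hyps by (auto simp: packets_def)
  have "word_sum (?A \<union> ?B) (pmf tx) t (all_span (insert i I)) = word_sum (?A \<union> ?B) (pmf tx) t
      (\<lambda>xs. all_span {i} (filter (\<lambda>a. a \<in> ?A) xs) * all_span I (filter (\<lambda>a. a \<in> ?B) xs))" for t
  proof (rule word_sum_cong)
    fix xs assume xs: "set xs \<subseteq> ?A \<union> ?B"
    have "filter (\<lambda>a. fst a = i) (filter (\<lambda>a. a \<in> ?A) xs) = filter (\<lambda>a. fst a = i) xs"
      using xs insert.hyps by (auto intro!: filter_cong simp: packets_def)
    moreover have "filter (\<lambda>a. fst a = l) (filter (\<lambda>a. a \<in> ?B) xs) = filter (\<lambda>a. fst a = l) xs" if "l \<in> I" for l
      using xs that insert.hyps by (auto intro!: filter_cong simp: packets_def)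
    ultimately show "all_span (insert i I) xs
        = all_span {i} (filter (\<lambda>a. a \<in> ?A) xs) * all_span I (filter (\<lambda>a. a \<in> ?B) xs)"
      using insert.hyps by (simp add: all_span_def del: filter_filter)
  qed simp
  then have "egf (\<lambda>t. word_sum (packets (insert i I)) (pmf tx) t (all_span (insert i I))) x
      = egf (\<lambda>t. word_sum ?A (pmf tx) t (all_span {i})) x * egf (\<lambda>t. word_sum ?B (pmf tx) t (all_span I)) x"
    unfolding un using insert.hyps disj
    by (simp add: egf_word_sum_union finite_packets abs_all_span_le)
  then show ?case
    using insert by (simp add: egf_word_sum_single)
qed

lemma egf_success_prob: "egf success_prob x = (\<Prod>i<n. egf (span_prob i) (\<rho> i * x))"
  unfolding success_prob_def[abs_def] by (rule egf_word_sum_packets) auto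

end

section \<open>Estimates for the spanning probabilities\<close>

text \<open>Below m spanning is impossible and the value 1 is the exact failure probability; from m
  on the value is a geometric majorant of minus the logarithm of the spanning probability.\<close>

definition bound_coeff :: "nat \<Rightarrow> nat \<Rightarrow> nat \<Rightarrow> real" where
  "bound_coeff q m k = (if k < m then 1 else alpha q m * real q ^ m / real q ^ k)"

lemma S_eq_egf: "S m x = egf (\<lambda>k. of_bool (k < m)) x"
  unfolding S_def egf_def by (subst suminf_finite[of "{..<m}"]) auto

text \<open>\<open>1 - s * c\<close> is a convex combination of 1 and \<open>1 - c\<close>, and ln 1
  = 0.\<close>

lemma ln_one_minus_scaled:
  fixes c s :: real
  assumes "0 \<le> c" "c < 1" "0 \<le> s" "s \<le> 1"
  shows "s * ln (1 - c) \<le> ln (1 - s * c)"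
proof -
  have "(1 - s) * ln 1 + s * ln (1 - c) \<le> ln ((1 - s) *\<^sub>R 1 + s *\<^sub>R (1 - c))"
    by (rule concave_onD[OF ln_concave]) (use assms in auto)
  then show ?thesis
    by (simp add: algebra_simps)
qed

text \<open>The term 3/8 / 2^m is what makes the induction close from m = 2 on.\<close>

lemma half_powers_prod_ge: "9 / 32 + 3 / 8 / 2 ^ m \<le> (\<Prod>r<m. 1 - 1 / 2 ^ Suc r :: real)"
proof (induction m rule: less_induct)
  case (less m)
  consider "m = 0" | "m = 1" | k where "m = Suc k" "k \<ge> 2 \<or> k = 1"
    by (cases m) force+
  then show ?case
  proof cases
    case (3 k)
    then consider "k = 1" | "k \<ge> 2" by auto
    then show ?thesis
    proof cases
      case 1
      then show ?thesis
        using 3 by (simp add: numeral_2_eq_2)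
    next
      case 2
      define u :: real where "u = 1 / 2 ^ k"
      have u: "0 < u" "u \<le> 1 / 4"
        using power_increasing[OF 2, of "2::real"] by (auto simp: u_def field_simps)
      \<comment> \<open>The right side exceeds the left by (3/16) u (1/4 - u), so the estimate is an
        equality at k = 2.\<close>
      have "9 / 32 + 3 / 8 * (u / 2) \<le> (9 / 32 + 3 / 8 * u) * (1 - u / 2)"
        using mult_nonneg_nonneg[of u "1 / 4 - u"] u by (simp add: field_simps)
      also have "\<dots> \<le> (\<Prod>r<k. 1 - 1 / 2 ^ Suc r) * (1 - u / 2)"
        using less.IH[of k] 3 u by (intro mult_right_mono) (auto simp: u_def)
      finally show ?thesis
        using 3 by (simp add: u_def mult.commute)
    qed
  qed auto
qed

text \<open>This is 1/c < e^(1 + c) for c = 9/32, the form in which \<open>alpha_less\<close> uses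
  the constant. Taking the eighth root brings the argument down to 41/256, where the quadratic
  Taylor bound is sharp enough.\<close>

lemma exp_41_32: "32 / 9 < exp (41 / 32 :: real)"
proof -
  have "(32 / 9 :: real) < (1 + 41 / 256 + (41 / 256)\<^sup>2 / 2) ^ 8"
    by (simp add: power2_eq_square power_divide)
  also have "\<dots> \<le> exp (41 / 256) ^ 8"
    by (intro power_mono exp_lower_Taylor_quadratic) auto
  also have "\<dots> = exp (41 / 32)"
    by (simp flip: exp_of_nat_mult)
  finally show ?thesis .
qed

section \<open>Comparing the spanning probabilities with the bounding coefficients\<close>

locale span_bound =
  fixes q m :: nat
  assumes q2: "q \<ge> 2" and m_pos: "m > 0"
begin

definition P :: "nat \<Rightarrow> real" where
  "P k = (\<Prod>j<m. 1 - real q ^ j / real q ^ k)"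

abbreviation "\<alpha> \<equiv> alpha q m"

lemma frac_lt_1: "j < k \<Longrightarrow> 0 < real q ^ j / real q ^ k \<and> real q ^ j / real q ^ k < 1"
  using q2 by (simp add: power_strict_increasing)

lemma P_pos: "m \<le> k \<Longrightarrow> 0 < P k"
  unfolding P_def using frac_lt_1 by (intro prod_pos) simp

lemma P_zero: "k < m \<Longrightarrow> P k = 0"
  unfolding P_def using q2 by (auto intro: bexI[of _ k])

lemma P_nonneg: "0 \<le> P k"
  using P_pos[of k] P_zero[of k] by (cases "k < m") auto

lemma P_le_1: "P k \<le> 1"
proof (cases "k < m")
  case False
  have "P k \<le> (\<Prod>j<m. 1)"
    unfolding P_def using False frac_lt_1[of _ k] by (intro prod_mono) (auto intro: less_imp_le)
  then show ?thesis
    by simp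
qed (simp add: P_zero)

lemma alpha_eq: "\<alpha> = - (\<Sum>j<m. ln (1 - real q ^ j / real q ^ m))"
  unfolding alpha_def using q2 by (auto intro!: sum.cong simp: power_diff)

lemma ln_P: "m \<le> k \<Longrightarrow> ln (P k) = (\<Sum>j<m. ln (1 - real q ^ j / real q ^ k))"
  unfolding P_def
proof (rule ln_prod)
  show "1 - real q ^ j / real q ^ k \<noteq> 0" if "m \<le> k" "j \<in> {..<m}" for j
  proof -
    have "j < k"
      using that by simp
    then show ?thesis
      using frac_lt_1[of j k] by linarith
  qed
qed simp

lemma exp_minus_alpha: "exp (- \<alpha>) = P m"
  using P_pos[of m] by (simp add: alpha_eq flip: ln_P)

lemma P_m_lt_1: "P m < 1"
proof -
  have "P m < (\<Prod>j<m. 1)"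
    unfolding P_def
  proof (rule prod_mono_strict[where i = 0])
    show "0 \<le> 1 - real q ^ j / real q ^ m \<and> 1 - real q ^ j / real q ^ m \<le> 1" if "j \<in> {..<m}" for j
      using that frac_lt_1[of j m] by simp
  qed (use m_pos q2 in auto)
  then show ?thesis
    by simp
qed

lemma alpha_pos: "0 < \<alpha>"
  using P_m_lt_1 by (simp flip: exp_minus_alpha)

text \<open>Each factor 1 - q^(-r) is smallest at q = 2, and listing the factors of
  \<open>P m\<close> backwards gives r = 1, ..., m.\<close>

lemma P_m_ge: "9 / 32 \<le> P m"
proof -
  have "9 / 32 \<le> 9 / 32 + 3 / 8 / (2 ^ m :: real)"
    by simp
  also have "\<dots> \<le> (\<Prod>r<m. 1 - 1 / 2 ^ Suc r :: real)"
    by (rule half_powers_prod_ge)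
  also have "\<dots> \<le> (\<Prod>r<m. 1 - 1 / real q ^ Suc r)"
  proof (intro prod_mono conjI)
    fix r
    have le: "2 ^ Suc r \<le> real q ^ Suc r"
      using q2 by (intro power_mono) auto
    have "(1::real) \<le> 2 ^ Suc r"
      by (rule one_le_power) simp
    then show "0 \<le> 1 - 1 / (2 ^ Suc r :: real)"
      by (simp add: field_simps)
    show "1 - 1 / 2 ^ Suc r \<le> 1 - 1 / real q ^ Suc r"
      using le by (intro diff_left_mono divide_left_mono mult_pos_pos) (use q2 in auto)
  qed
  also have "\<dots> = (\<Prod>j<m. 1 - 1 / real q ^ Suc (m - Suc j))"
    by (rule prod.nat_diff_reindex[symmetric])
  also have "\<dots> = P m"
    unfolding P_def using q2 by (intro prod.cong) (auto simp: power_diff Suc_diff_Suc simp del: power_Suc)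
  finally show ?thesis .
qed

text \<open>With c = 9/32 \<le> \<open>P m\<close>: \<alpha> = - ln (P m) \<le> ln (1/c) < 1 + c
  \<le> 1 + \<open>P m\<close>.\<close>

lemma alpha_less: "\<alpha> < 1 + P m"
proof -
  have "exp \<alpha> = 1 / P m"
    by (simp add: exp_minus_alpha[symmetric] exp_minus field_simps)
  also have "\<dots> \<le> 1 / (9 / 32)"
    using P_m_ge by (intro divide_left_mono) auto
  also have "\<dots> < exp (41 / 32)"
    using exp_41_32 by simp
  finally show ?thesis
    using P_m_ge by simp
qed

abbreviation "b \<equiv> bound_coeff q m"

lemma b_nonneg: "0 \<le> b k"
  using alpha_pos by (simp add: bound_coeff_def)

lemma b_m: "b m = \<alpha>"
  using q2 by (simp add: bound_coeff_def)

text \<open>Put s = q^(m - k). Passing from m to k multiplies every fraction in the product by s, so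
  concavity gives ln (P k) \<ge> s ln (P m) = - s \<alpha>, and 1 - p \<le> - ln p finishes.\<close>

lemma P_bound: "1 - P k \<le> b k"
proof (cases "k < m")
  case False
  define s where "s = real q ^ m / real q ^ k"
  have s: "0 \<le> s" "s \<le> 1"
    using q2 False by (auto simp: s_def intro!: power_increasing)
  have eq: "real q ^ j / real q ^ k = s * (real q ^ j / real q ^ m)" for j
    using q2 by (simp add: s_def)
  have "s * ln (P m) = (\<Sum>j<m. s * ln (1 - real q ^ j / real q ^ m))"
    by (simp add: ln_P sum_distrib_left)
  also have "\<dots> \<le> (\<Sum>j<m. ln (1 - real q ^ j / real q ^ k))"
    unfolding eq using s frac_lt_1[of _ m] by (intro sum_mono ln_one_minus_scaled) auto
  also have "\<dots> = ln (P k)"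
    using False by (simp add: ln_P)
  also have "\<dots> \<le> P k - 1"
    using False by (intro ln_le_minus_one P_pos) simp
  finally show ?thesis
    using False by (simp add: bound_coeff_def alpha_eq s_def ln_P mult.commute)
qed (simp add: P_zero bound_coeff_def)

text \<open>One strict coefficient is enough to make the comparison of the generating functions
  strict at positive arguments.\<close>

lemma P_bound_strict: "1 - P m < b m"
  using exp_minus_greater[of \<alpha>] alpha_pos by (simp add: b_m exp_minus_alpha)

lemma b_bound_strict: "b m < 1 + P m"
  using alpha_less by (simp add: b_m)

text \<open>Beyond k = m the fraction q^m / q^k is at most 1/2 and \<alpha> \<le> 2, so
  \<open>b k\<close> is at most 1 already; the case k = m is \<open>alpha_less\<close>.\<close>

lemma b_bound: "b k \<le> 1 + P k"
proof -
  consider "k < m" | "k = m" | "k > m"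
    by linarith
  then show ?thesis
  proof cases
    case 3
    have "2 * real q ^ m \<le> real q ^ Suc m"
      using q2 by simp
    also have "\<dots> \<le> real q ^ k"
      using 3 q2 by (intro power_increasing) auto
    finally have "real q ^ m / real q ^ k \<le> 1 / 2"
      using q2 by (simp add: field_simps)
    moreover have "\<alpha> \<le> 2"
      using alpha_less P_le_1[of m] by simp
    ultimately have "\<alpha> * (real q ^ m / real q ^ k) \<le> 2 * (1 / 2)"
      using alpha_pos by (intro mult_mono) auto
    then show ?thesis
      using 3 P_nonneg[of k] by (simp add: bound_coeff_def)
  qed (use b_bound_strict P_nonneg[of k] in \<open>auto simp: bound_coeff_def\<close>)
qed

lemma entire_P: "entire_egf P" and entire_b: "entire_egf b"
proof -
  show "entire_egf P"
    using P_nonneg P_le_1 by (intro entire_egf_bounded[where C = 1 and B = 1]) simp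
  have "b k \<le> 2" for k
    using b_bound[of k] P_le_1[of k] by simp
  then show "entire_egf b"
    using b_nonneg by (intro entire_egf_bounded[where C = 2 and B = 1]) simp
qed

lemma summable_b: "summable b"
proof (rule summable_comparison_test')
  show "summable (\<lambda>k. \<alpha> * real q ^ m * (1 / real q) ^ k)"
    using q2 by (intro summable_mult summable_geometric) simp
  show "norm (b k) \<le> \<alpha> * real q ^ m * (1 / real q) ^ k" if "k \<ge> m" for k
    using that b_nonneg[of k] by (simp add: bound_coeff_def power_divide)
qed

text \<open>The tail from m on of the exponential series at x / q is the full series minus its first
  m terms, which explains the two \<alpha>-terms.\<close>

lemma egf_b: "egf b x = S m x + \<alpha> * real q ^ m * exp (x / real q) - \<alpha> * real q ^ m * S m (x / real q)"
proof -
  let ?C = "\<alpha> * real q ^ m"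
  let ?s = "\<lambda>k. of_bool (k < m) :: real"
  have e: "entire_egf ?s"
    by (rule entire_egf_bounded[where C = 1 and B = 1]) simp
  have "(\<lambda>k. ?s k / fact k * x ^ k + ?C * (1 / fact k * (x / real q) ^ k) - ?C * (?s k / fact k * (x / real q) ^ k))
      sums (S m x + ?C * exp (x / real q) - ?C * S m (x / real q))"
    unfolding S_eq_egf egf_one[symmetric]
    by (intro sums_add sums_diff sums_mult sums_egf e entire_egf_one)
  also have "(\<lambda>k. ?s k / fact k * x ^ k + ?C * (1 / fact k * (x / real q) ^ k) - ?C * (?s k / fact k * (x / real q) ^ k))
      = (\<lambda>k. b k / fact k * x ^ k)"
    using q2 by (auto simp: bound_coeff_def fun_eq_iff power_divide)
  finally show ?thesis
    by (simp add: egf_def sums_iff)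
qed

text \<open>Both halves of the absolute value compare with exp x, the generating function of the
  constant 1: the coefficients P + b - 1 and 1 + P - b are nonnegative, and positive at k =
  m.\<close>

lemma egf_b_bounds:
  assumes "0 < x"
  shows "\<bar>1 - exp (- x) * egf b x\<bar> < exp (- x) * egf P x"
proof -
  have "0 < egf (\<lambda>k. P k + b k - 1) x"
    using P_bound P_bound_strict assms
    by (intro egf_pos[where m = m] egf_diff(1) egf_add(1) entire_P entire_b entire_egf_one) (auto simp: algebra_simps)
  then have "exp x < egf P x + egf b x"
    by (simp add: egf_diff egf_add entire_P entire_b entire_egf_one egf_one)
  then have 1: "1 < exp (- x) * egf P x + exp (- x) * egf b x"
    by (simp add: exp_minus field_simps)
  have "0 < egf (\<lambda>k. 1 + P k - b k) x"
    using b_bound b_bound_strict assms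
    by (intro egf_pos[where m = m] egf_diff(1) egf_add(1) entire_P entire_b entire_egf_one) (auto simp: algebra_simps)
  then have "egf b x < exp x + egf P x"
    by (simp add: egf_diff egf_add entire_P entire_b entire_egf_one egf_one)
  then have "exp (- x) * egf b x < 1 + exp (- x) * egf P x"
    by (simp add: exp_minus field_simps)
  with 1 show ?thesis
    by linarith
qed

lemma egf_P_le: "0 \<le> x \<Longrightarrow> exp (- x) * egf P x \<le> 1"
proof -
  assume "0 \<le> x"
  then have "egf P x \<le> egf (\<lambda>_. 1) x"
    using sums_egf[OF entire_P, of x] sums_egf[OF entire_egf_one, of x] P_le_1
    using \<open>0 \<le> x\<close> P_le_1 mult_right_mono[of "P _" 1 "x ^ _"]
    unfolding egf_def by (intro suminf_le) (auto simp: sums_iff intro!: divide_right_mono)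
  then show ?thesis
    by (simp add: egf_one exp_minus field_simps)
qed

end

section \<open>Moments of the number of transmissions\<close>

text \<open>Exchange of sum and integral, and the Gamma integral of
  \<open>x ^ (k + r) * exp (- x)\<close>. It is used with r = 0 for the plain sum of
  \<open>d\<close> and with r = 1 for weights k + 1.\<close>

lemma nn_integral_gamma_weight:
  assumes "\<And>k. 0 \<le> d k" "entire_egf d"
  shows "(\<integral>\<^sup>+x\<in>{0..}. ennreal (x ^ r * (exp (- x) * egf d x)) \<partial>lborel)
    = (\<Sum>k. ennreal (d k * fact (k + r) / fact k))"
proof -
  have "(\<integral>\<^sup>+x\<in>{0..}. ennreal (x ^ r * (exp (- x) * egf d x)) \<partial>lborel)
      = (\<integral>\<^sup>+x. (\<Sum>k. ennreal (d k / fact k) * (ennreal (x ^ (k + r) * exp (- x)) * indicator {0..} x)) \<partial>lborel)"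
  proof (rule nn_integral_cong)
    fix x :: real
    show "ennreal (x ^ r * (exp (- x) * egf d x)) * indicator {0..} x
        = (\<Sum>k. ennreal (d k / fact k) * (ennreal (x ^ (k + r) * exp (- x)) * indicator {0..} x))"
    proof (cases "0 \<le> x")
      case True
      have "(\<lambda>k. (x ^ r * exp (- x)) * (d k / fact k * x ^ k)) sums ((x ^ r * exp (- x)) * egf d x)"
        by (intro sums_mult sums_egf assms)
      also have "(\<lambda>k. (x ^ r * exp (- x)) * (d k / fact k * x ^ k)) = (\<lambda>k. d k / fact k * (x ^ (k + r) * exp (- x)))"
        by (simp add: fun_eq_iff power_add mult_ac)
      finally have s: "(\<lambda>k. d k / fact k * (x ^ (k + r) * exp (- x))) sums (x ^ r * (exp (- x) * egf d x))"
        by (simp add: mult_ac)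
      then have "(\<Sum>k. ennreal (d k / fact k * (x ^ (k + r) * exp (- x)))) = ennreal (x ^ r * (exp (- x) * egf d x))"
        using True assms(1) by (subst suminf_ennreal2) (auto simp: sums_iff)
      moreover have "ennreal (d k / fact k * (x ^ (k + r) * exp (- x)))
          = ennreal (d k / fact k) * ennreal (x ^ (k + r) * exp (- x))" for k
        using True assms(1) by (intro ennreal_mult) auto
      ultimately show ?thesis
        using True by simp
    qed simp
  qed
  also have "\<dots> = (\<Sum>k. ennreal (d k / fact k) * (\<integral>\<^sup>+x. ennreal (x ^ (k + r) * exp (- x)) * indicator {0..} x \<partial>lborel))"
    by (subst nn_integral_suminf) (auto simp: nn_integral_cmult)
  also have "\<dots> = (\<Sum>k. ennreal (d k * fact (k + r) / fact k))"
    using assms(1) unfolding nn_intergal_power_times_exp_Ici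
    by (intro suminf_cong) (simp flip: ennreal_mult')
  finally show ?thesis .
qed

lemma continuous_on_egf: "entire_egf c \<Longrightarrow> continuous_on A (egf c)"
  using DERIV_egf by (meson DERIV_isCont continuous_at_imp_continuous_on)

lemma borel_measurable_egf: "entire_egf c \<Longrightarrow> egf c \<in> borel_measurable borel"
  by (intro borel_measurable_continuous_onI continuous_on_egf)

context generation_channel
begin

lemma span_prob_bounds:
  assumes "i < n"
  shows "entire_egf (span_prob i)" "entire_egf (\<lambda>k. span_prob i (Suc k))"
  using span_prob_nonneg[OF assms] span_prob_le_1[OF assms]
  by (auto intro!: entire_egf_bounded[where C = 1 and B = 1])

lemma success_prob_bounds: "0 \<le> success_prob t" "success_prob t \<le> 1"
  by (simp_all flip: prob_all_decodable)

lemma entire_success_prob: "entire_egf success_prob" "entire_egf (\<lambda>t. success_prob (Suc t))"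
  using success_prob_bounds by (auto intro!: entire_egf_bounded[where C = 1 and B = 1])

text \<open>The tail-sum formula with weights y^k / k!; r = 0 and r = 1 give the two expectations of
  the theorem. Truncated subtraction agrees with the convention S_m = 0 for m \<le> 0, and k < M - r
  means k + r < M even when it truncates.\<close>

lemma integral_S_M_count:
  assumes "i < n" "0 \<le> y"
  shows "(\<integral>\<omega>. S (M_count g i \<omega> - r) y \<partial>\<Omega>) = exp y - egf (\<lambda>k. span_prob i (k + r)) y"
proof -
  have [measurable]: "M_count g i \<in> measurable \<Omega> (count_space UNIV)"
    unfolding \<Omega>_stream by (rule measurable_M_count)
  have e: "entire_egf (\<lambda>k. span_prob i (k + r))"
    using span_prob_nonneg[OF assms(1)] span_prob_le_1[OF assms(1)]
    by (auto intro!: entire_egf_bounded[where C = 1 and B = 1])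
  have "{\<omega> \<in> space \<Omega>. k < M_count g i \<omega> - r} = {\<omega>. k + r < M_count g i \<omega>}" for k
    by auto
  then have pr: "prob {\<omega> \<in> space \<Omega>. k < M_count g i \<omega> - r} = 1 - span_prob i (k + r)" for k
    using prob_M_count_greater[OF assms(1)] by simp
  have "summable (\<lambda>k. y ^ k / fact k)"
    using summable_exp_generic[of y] by (simp add: divide_inverse mult.commute)
  then have "(\<integral>\<omega>. S (M_count g i \<omega> - r) y \<partial>\<Omega>) = (\<Sum>k. y ^ k / fact k * (1 - span_prob i (k + r)))"
    unfolding S_def pr[symmetric] using assms(2)
    by (intro integral_sum_lessThan finite_measure_axioms) auto
  also have "\<dots> = egf (\<lambda>k. 1 - span_prob i (k + r)) y"
    by (simp add: egf_def mult.commute)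
  also have "\<dots> = exp y - egf (\<lambda>k. span_prob i (k + r)) y"
    using e by (simp add: egf_diff entire_egf_one egf_one)
  finally show ?thesis .
qed

text \<open>Since the rho_i sum to 1, \<open>exp (- x)\<close> splits into one factor for each
  generation.\<close>

lemma exp_egf_success_prob:
  "exp (- x) * egf success_prob x = (\<Prod>i<n. exp (- \<rho> i * x) * egf (span_prob i) (\<rho> i * x))"
proof -
  have "exp (- x) = exp (\<Sum>i<n. - \<rho> i * x)"
    by (simp add: sum_negf \<rho>_sum flip: sum_distrib_right)
  then show ?thesis
    by (simp add: exp_sum egf_success_prob prod.distrib)
qed

lemma nn_integral_sum_W_total:
  assumes "\<And>k. 0 \<le> c k"
  shows "(\<integral>\<^sup>+\<omega>. ennreal (\<Sum>k<W_total n g \<omega>. c k) \<partial>\<Omega>) = (\<Sum>k. ennreal (c k * (1 - success_prob k)))"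
proof -
  have [measurable]: "W_total n g \<in> measurable \<Omega> (count_space UNIV)"
    unfolding \<Omega>_stream by (rule measurable_W_total)
  show ?thesis
    using assms success_prob_bounds
    by (subst nn_integral_sum_lessThan) (simp_all add: emeasure_eq_measure prob_W_total_greater ennreal_mult)
qed

lemma suminf_failure_prob:
  "(\<Sum>k. ennreal (1 - success_prob k))
    = (\<integral>\<^sup>+x\<in>{0..}. ennreal (1 - exp (- x) * egf success_prob x) \<partial>lborel)"
proof -
  have "(\<Sum>k. ennreal (1 - success_prob k))
      = (\<integral>\<^sup>+x\<in>{0..}. ennreal (x ^ 0 * (exp (- x) * egf (\<lambda>t. 1 - success_prob t) x)) \<partial>lborel)"
    using success_prob_bounds
    by (subst nn_integral_gamma_weight) (auto intro!: egf_diff entire_egf_one entire_success_prob)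
  then show ?thesis
    by (simp add: egf_diff entire_egf_one entire_success_prob egf_one exp_minus field_simps)
qed

text \<open>The index 0 contributes nothing, and after the shift the weight k + 1 is (k + 1)! / k!,
  the case r = 1 of the Gamma weights. The shift is what produces the derivative of the generating
  function.\<close>

lemma suminf_index_failure_prob:
  "(\<Sum>k. ennreal (real k * (1 - success_prob k)))
    = (\<integral>\<^sup>+x\<in>{0..}. ennreal (x * (1 - exp (- x) * egf (\<lambda>t. success_prob (Suc t)) x)) \<partial>lborel)"
proof -
  have "(\<lambda>k. ennreal (real (Suc k) * (1 - success_prob (Suc k))))
      sums (\<Sum>k. ennreal (real (Suc k) * (1 - success_prob (Suc k))))"
    by (intro summable_sums summableI)
  from sums_Suc[of "\<lambda>k. ennreal (real k * (1 - success_prob k))", OF this]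
  have "(\<Sum>k. ennreal (real k * (1 - success_prob k)))
      = (\<Sum>k. ennreal (real (Suc k) * (1 - success_prob (Suc k))))"
    by (simp add: sums_iff)
  also have "\<dots> = (\<Sum>k. ennreal ((1 - success_prob (Suc k)) * fact (k + 1) / fact k))"
    by (intro suminf_cong) (simp add: mult.commute)
  also have "\<dots> = (\<integral>\<^sup>+x\<in>{0..}. ennreal (x ^ 1 * (exp (- x) * egf (\<lambda>t. 1 - success_prob (Suc t)) x)) \<partial>lborel)"
    using success_prob_bounds
    by (subst nn_integral_gamma_weight) (auto intro!: egf_diff entire_egf_one entire_success_prob)
  finally show ?thesis
    by (simp add: egf_diff entire_egf_one entire_success_prob egf_one exp_minus field_simps)
qed

lemma expectation_W_total:
  "(\<integral>\<^sup>+\<omega>. of_nat (W_total n g \<omega>) \<partial>\<Omega>)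
    = (\<integral>\<^sup>+x\<in>{0..}. ennreal (1 - exp (- x) * egf success_prob x) \<partial>lborel)"
  using nn_integral_sum_W_total[of "\<lambda>_. 1"]
  by (simp add: suminf_failure_prob ennreal_of_nat_eq_real_of_nat)

lemma expectation_W_total_squared:
  "(\<integral>\<^sup>+\<omega>. (of_nat (W_total n g \<omega>))\<^sup>2 \<partial>\<Omega>)
    = 2 * (\<integral>\<^sup>+x\<in>{0..}. ennreal (x * (1 - exp (- x) * egf (\<lambda>t. success_prob (Suc t)) x)) \<partial>lborel)
      + (\<integral>\<^sup>+x\<in>{0..}. ennreal (1 - exp (- x) * egf success_prob x) \<partial>lborel)"
proof -
  let ?d = "\<lambda>k. 1 - success_prob k"
  have d: "0 \<le> ?d k" for k
    using success_prob_bounds by simp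
  \<comment> \<open>N^2 is the sum of the first N odd numbers, so the tail-sum formula applies with
    weights 2k + 1.\<close>
  have sq: "(of_nat N)\<^sup>2 = ennreal (\<Sum>k<N. 2 * real k + 1)" for N
  proof -
    have "(\<Sum>k<N. 2 * real k + 1) = (real N)\<^sup>2"
      by (induction N) (simp_all add: power2_eq_square algebra_simps)
    then show ?thesis
      by (simp add: ennreal_of_nat_eq_real_of_nat ennreal_power)
  qed
  have "(\<integral>\<^sup>+\<omega>. (of_nat (W_total n g \<omega>))\<^sup>2 \<partial>\<Omega>) = (\<Sum>k. ennreal ((2 * real k + 1) * ?d k))"
    unfolding sq by (rule nn_integral_sum_W_total) simp
  also have "\<dots> = (\<Sum>k. 2 * ennreal (real k * ?d k) + ennreal (?d k))"
  proof (rule suminf_cong)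
    fix k
    have "ennreal ((2 * real k + 1) * ?d k) = ennreal (2 * (real k * ?d k) + ?d k)"
      by (simp add: algebra_simps)
    also have "\<dots> = ennreal 2 * ennreal (real k * ?d k) + ennreal (?d k)"
      using d[of k] by (simp add: ennreal_plus ennreal_mult del: ennreal_numeral)
    finally show "ennreal ((2 * real k + 1) * ?d k) = 2 * ennreal (real k * ?d k) + ennreal (?d k)"
      by simp
  qed
  also have "\<dots> = 2 * (\<Sum>k. ennreal (real k * ?d k)) + (\<Sum>k. ennreal (?d k))"
    by (simp add: suminf_add[OF summableI summableI, symmetric])
  finally show ?thesis
    by (simp only: suminf_failure_prob suminf_index_failure_prob)
qed

lemma egf_span_prob_pos:
  assumes "i < n" "0 < y"
  shows "0 < egf (span_prob i) y"
proof -
  have "eventually (\<lambda>k. 0 < span_prob i k) sequentially"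
    by (rule order_tendstoD(1)[OF span_prob_tendsto_1]) simp
  then obtain k where "0 < span_prob i k"
    by (auto simp: eventually_sequentially)
  then show ?thesis
    using assms span_prob_nonneg by (intro egf_pos[where m = k] span_prob_bounds) auto
qed

text \<open>The shifted series is the derivative of the product in \<open>egf_success_prob\<close>,
  written as the product times its logarithmic derivative; this needs nonzero factors, hence x > 0.
  The exponentials cancel in each quotient.\<close>

lemma exp_egf_success_prob_Suc:
  assumes "0 < x"
  shows "exp (- x) * egf (\<lambda>t. success_prob (Suc t)) x
    = (\<Sum>i<n. \<rho> i * (exp (- \<rho> i * x) * egf (\<lambda>k. span_prob i (Suc k)) (\<rho> i * x))
          / (exp (- \<rho> i * x) * egf (span_prob i) (\<rho> i * x))
        * (\<Prod>j<n. exp (- \<rho> j * x) * egf (span_prob j) (\<rho> j * x)))"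
proof -
  have "((\<lambda>x. egf (span_prob i) (\<rho> i * x)) has_real_derivative
      \<rho> i * egf (\<lambda>k. span_prob i (Suc k)) (\<rho> i * x)) (at x)" if "i < n" for i
  proof -
    have "((\<lambda>x. \<rho> i * x) has_real_derivative \<rho> i) (at x)"
      by (auto intro!: derivative_eq_intros)
    from DERIV_chain2[OF DERIV_egf[OF span_prob_bounds(1)[OF that]] this] show ?thesis
      by (simp add: mult.commute)
  qed
  then have "((\<lambda>x. \<Prod>i<n. egf (span_prob i) (\<rho> i * x)) has_real_derivative
      (\<Prod>i<n. egf (span_prob i) (\<rho> i * x)) * (\<Sum>i<n. \<rho> i * egf (\<lambda>k. span_prob i (Suc k)) (\<rho> i * x)
        / egf (span_prob i) (\<rho> i * x))) (at x)"
  proof (intro has_field_derivative_prod')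
    show "egf (span_prob i) (\<rho> i * x) \<noteq> 0" if "i \<in> {..<n}" for i
      using egf_span_prob_pos[of i "\<rho> i * x"] \<rho>_pos[of i] assms that by simp
  qed simp
  then have "(egf success_prob has_real_derivative
      egf success_prob x * (\<Sum>i<n. \<rho> i * egf (\<lambda>k. span_prob i (Suc k)) (\<rho> i * x)
        / egf (span_prob i) (\<rho> i * x))) (at x)"
    by (simp flip: egf_success_prob)
  then have "egf (\<lambda>t. success_prob (Suc t)) x = egf success_prob x *
      (\<Sum>i<n. \<rho> i * egf (\<lambda>k. span_prob i (Suc k)) (\<rho> i * x) / egf (span_prob i) (\<rho> i * x))"
    by (rule DERIV_unique[OF DERIV_egf[OF entire_success_prob(1)]])
  then show ?thesis
    unfolding exp_egf_success_prob[symmetric] by (simp add: sum_distrib_left sum_distrib_right mult_ac)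
qed

section \<open>The strict upper bound for the first moment\<close>

definition miss_bound :: "nat \<Rightarrow> real \<Rightarrow> real" where
  "miss_bound i y = exp (- y) * egf (bound_coeff CARD('a) (g i)) y"

text \<open>The last claim holds because y^k e^(-y) / k! has integral 1 on the half-line, so the
  integral is the sum of the coefficients, which decay geometrically.\<close>

lemma miss_bound_facts:
  assumes "i < n" "0 < g i"
  shows "0 < y \<Longrightarrow> \<bar>1 - miss_bound i y\<bar> < exp (- y) * egf (span_prob i) y"
    and "0 \<le> y \<Longrightarrow> exp (- y) * egf (span_prob i) y \<le> 1"
    and "miss_bound i \<in> borel_measurable borel"
    and "(\<integral>\<^sup>+y\<in>{0..}. ennreal (miss_bound i y) \<partial>lborel) < \<infinity>"
proof -
  have "2 \<le> CARD('a)"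
    using card_mono[of UNIV "{0, 1::'a}"] by simp
  then interpret B: span_bound "CARD('a)" "g i"
    by unfold_locales (use assms in auto)
  have P: "span_prob i = B.P"
    by (simp add: fun_eq_iff span_prob_def B.P_def q_def)
  show "0 < y \<Longrightarrow> \<bar>1 - miss_bound i y\<bar> < exp (- y) * egf (span_prob i) y"
    unfolding miss_bound_def P by (rule B.egf_b_bounds)
  show "0 \<le> y \<Longrightarrow> exp (- y) * egf (span_prob i) y \<le> 1"
    unfolding P by (rule B.egf_P_le)
  have [measurable]: "egf B.b \<in> borel_measurable borel"
    by (rule borel_measurable_egf[OF B.entire_b])
  show "miss_bound i \<in> borel_measurable borel"
    unfolding miss_bound_def[abs_def] by measurable
  have "(\<integral>\<^sup>+y\<in>{0..}. ennreal (y ^ 0 * (exp (- y) * egf B.b y)) \<partial>lborel) = (\<Sum>k. ennreal (B.b k * fact (k + 0) / fact k))"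
    by (rule nn_integral_gamma_weight[OF B.b_nonneg B.entire_b])
  also have "\<dots> = ennreal (suminf B.b)"
    using B.summable_b B.b_nonneg by (simp add: suminf_ennreal2)
  finally show "(\<integral>\<^sup>+y\<in>{0..}. ennreal (miss_bound i y) \<partial>lborel) < \<infinity>"
    by (simp add: miss_bound_def)
qed

text \<open>Strictness follows from a strict pointwise inequality on a set of positive measure once
  the smaller integral is finite. Finiteness of the larger one also ensures that the Lebesgue
  integral on the right is the true value and not the default 0.\<close>

lemma expectation_W_total_less:
  assumes "n \<ge> 1" and g_pos: "\<And>i. i < n \<Longrightarrow> 0 < g i"
  shows "(\<integral>\<^sup>+\<omega>. of_nat (W_total n g \<omega>) \<partial>\<Omega>)
    < ennreal (LBINT x:{0..}. 1 - (\<Prod>i<n. 1 - miss_bound i (\<rho> i * x)))"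
proof -
  let ?D = "\<lambda>i x. exp (- (\<rho> i * x)) * egf (span_prob i) (\<rho> i * x)"
  define F where "F = (\<lambda>x. 1 - exp (- x) * egf success_prob x)"
  define G where "G = (\<lambda>x. 1 - (\<Prod>i<n. 1 - miss_bound i (\<rho> i * x)))"
  note facts = miss_bound_facts[OF _ g_pos]
  have [measurable]: "egf success_prob \<in> borel_measurable borel"
    by (rule borel_measurable_egf[OF entire_success_prob(1)])
  have [measurable]: "F \<in> borel_measurable borel"
    unfolding F_def by measurable
  have meas_T [measurable]: "(\<lambda>x. miss_bound i (\<rho> i * x)) \<in> borel_measurable borel" if "i < n" for i
    by (rule measurable_compose[OF _ facts(3)[OF that that]]) simp
  have [measurable]: "G \<in> borel_measurable borel"
    unfolding G_def by (intro borel_measurable_diff borel_measurable_prod borel_measurable_const meas_T) auto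
  have F: "F x = 1 - (\<Prod>i<n. ?D i x)" for x
    by (simp add: F_def exp_egf_success_prob)
  have y_pos: "0 < \<rho> i * x" if "0 < x" "i < n" for i x
    using that \<rho>_pos by simp
  have D: "\<bar>1 - miss_bound i (\<rho> i * x)\<bar> < ?D i x" "?D i x \<le> 1" if "0 < x" "i < n" for i x
    using facts[OF that(2) that(2)] y_pos[OF that] by (simp_all add: less_imp_le)
  have FG: "F x < G x" if "0 < x" for x
  proof -
    have "(\<Prod>i<n. 1 - miss_bound i (\<rho> i * x)) \<le> (\<Prod>i<n. \<bar>1 - miss_bound i (\<rho> i * x)\<bar>)"
      by (simp flip: abs_prod)
    also have "\<dots> < (\<Prod>i<n. ?D i x)"
      using D[OF that] \<open>n \<ge> 1\<close>
      by (intro prod_mono_strict[where i = 0]) (auto intro: less_imp_le order_le_less_trans[OF abs_ge_zero])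
    finally show ?thesis
      by (simp add: F G_def)
  qed
  have F_nonneg: "0 \<le> F x" if "0 < x" for x
    unfolding F using D[OF that] by (auto intro!: prod_le_1 less_imp_le[OF order_le_less_trans[OF abs_ge_zero]])
  \<comment> \<open>A product of numbers of absolute value at most 1 differs from 1 by at most the
    sum of the single differences, so \<open>G\<close> has an integrable majorant.\<close>
  have G_le: "G x \<le> (\<Sum>i<n. miss_bound i (\<rho> i * x))" if "0 < x" for x
  proof -
    have T_nonneg: "0 \<le> miss_bound i (\<rho> i * x)" if "i < n" for i
      using D[OF \<open>0 < x\<close> that] by linarith
    have "G x \<le> norm ((\<Prod>i<n. 1) - (\<Prod>i<n. 1 - miss_bound i (\<rho> i * x)))"
      by (simp add: G_def)
    also have "\<dots> \<le> (\<Sum>i<n. norm (1 - (1 - miss_bound i (\<rho> i * x))))"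
      using D[OF that] by (intro norm_prod_diff) (auto intro: less_imp_le order_less_le_trans)
    also have "\<dots> = (\<Sum>i<n. miss_bound i (\<rho> i * x))"
      using T_nonneg by simp
    finally show ?thesis .
  qed
  \<comment> \<open>The pointwise bounds are available for x > 0 only; the endpoint 0 is a null
    set.\<close>
  have pos: "AE x in lborel. x \<noteq> (0::real)"
    by (rule AE_lborel_singleton)
  have "(\<integral>\<^sup>+x\<in>{0..}. ennreal (G x) \<partial>lborel)
      \<le> (\<integral>\<^sup>+x. (\<Sum>i<n. ennreal (miss_bound i (\<rho> i * x)) * indicator {0..} x) \<partial>lborel)"
  proof (rule nn_integral_mono_AE, use pos in eventually_elim)
    case (elim x)
    show ?case
    proof (cases "0 < x")
      case True
      have "0 \<le> miss_bound i (\<rho> i * x)" if "i < n" for i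
        using D[OF True that] by linarith
      then show ?thesis
        using G_le[OF True] True by (subst sum_distrib_right[symmetric], subst sum_ennreal) (auto intro: ennreal_leI)
    qed (use elim in simp)
  qed
  also have "\<dots> = (\<Sum>i<n. \<integral>\<^sup>+x. ennreal (miss_bound i (\<rho> i * x)) * indicator {0..} x \<partial>lborel)"
    by (rule nn_integral_sum) (auto intro!: borel_measurable_times_ennreal measurable_compose[OF meas_T])
  also have "\<dots> < \<infinity>"
  proof -
    have "(\<integral>\<^sup>+x. ennreal (miss_bound i (\<rho> i * x)) * indicator {0..} x \<partial>lborel) < \<infinity>" if "i < n" for i
    proof -
      have [measurable]: "miss_bound i \<in> borel_measurable borel"
        using facts(3)[OF that that] .
      \<comment> \<open>Scaling by rho_i > 0 preserves the half-line, so the substitution y = rho_i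
        x applies.\<close>
      have "indicator {0..} (\<rho> i * x) = (indicator {0..} x :: ennreal)" for x
        using \<rho>_pos[OF that] by (simp add: indicator_def zero_le_mult_iff)
      then have "(\<integral>\<^sup>+y\<in>{0..}. ennreal (miss_bound i y) \<partial>lborel)
          = ennreal (\<rho> i) * (\<integral>\<^sup>+x. ennreal (miss_bound i (\<rho> i * x)) * indicator {0..} x \<partial>lborel)"
        using \<rho>_pos[OF that] by (subst nn_integral_real_affine[where c = "\<rho> i" and t = 0]) auto
      then show ?thesis
        using facts(4)[OF that that] \<rho>_pos[OF that] by (auto simp: ennreal_mult_less_top)
    qed
    then show ?thesis
      by simp
  qed
  finally have G_fin: "(\<integral>\<^sup>+x\<in>{0..}. ennreal (G x) \<partial>lborel) < \<infinity>" .
  have le: "AE x in lborel. ennreal (F x) * indicator {0..} x \<le> ennreal (G x) * indicator {0..} x"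
    using pos
  proof eventually_elim
    case (elim x)
    then show ?case
      using FG[of x] by (cases "0 < x") (auto intro: ennreal_leI)
  qed
  have "(\<integral>\<^sup>+x\<in>{0..}. ennreal (F x) \<partial>lborel) < (\<integral>\<^sup>+x\<in>{0..}. ennreal (G x) \<partial>lborel)"
  proof (rule nn_integral_less)
    show "(\<integral>\<^sup>+x\<in>{0..}. ennreal (F x) \<partial>lborel) \<noteq> \<infinity>"
      using nn_integral_mono_AE[OF le] G_fin by (auto simp: top_unique)
    show "\<not> (AE x in lborel. ennreal (G x) * indicator {0..} x \<le> ennreal (F x) * indicator {0..} x)"
    proof
      assume "AE x in lborel. ennreal (G x) * indicator {0..} x \<le> ennreal (F x) * indicator {0..} x"
      \<comment> \<open>Any interval of positive length in x > 0 gives the contradiction.\<close>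
      then have "AE x in lborel. x \<notin> {0<..<1::real}"
      proof eventually_elim
        case (elim x)
        then show ?case
          using FG[of x] F_nonneg[of x] by (auto simp: not_le ennreal_le_iff2)
      qed
      then have "emeasure lborel {0<..<1::real} = 0"
        by (subst (asm) AE_iff_measurable[of "{0<..<1}"]) auto
      then show False
        by simp
    qed
  qed (use le in auto)
  also have "(\<integral>\<^sup>+x\<in>{0..}. ennreal (G x) \<partial>lborel) = ennreal (LBINT x:{0..}. G x)"
  proof -
    have G_nonneg: "AE x in lborel. 0 \<le> indicator {0..} x * G x"
      using pos
    proof eventually_elim
      case (elim x)
      then show ?case
        using FG[of x] F_nonneg[of x] by (cases "0 < x") auto
    qed
    have eq: "ennreal (G x) * indicator {0..} x = ennreal (indicator {0..} x * G x)" for x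
      by (simp split: split_indicator)
    have "integrable lborel (\<lambda>x. indicator {0..} x * G x)"
      using G_fin unfolding eq by (intro integrableI_nonneg G_nonneg) auto
    then show ?thesis
      unfolding eq set_lebesgue_integral_def using nn_integral_eq_integral[OF _ G_nonneg] by simp
  qed
  finally show ?thesis
    unfolding expectation_W_total F_def G_def .
qed

end

theorem theorem5:
  fixes n :: nat and g :: "nat \<Rightarrow> nat" and \<rho> :: "nat \<Rightarrow> real"
    and \<Omega> :: "(nat \<times> (nat \<Rightarrow> 'a::{field,finite})) stream measure"
    and q :: nat and EM EM1 :: "nat \<Rightarrow> real \<Rightarrow> real"
  assumes n: "n \<ge> 1"
    and g_pos: "\<And>i. i < n \<Longrightarrow> g i > 0"
    and \<rho>_pos: "\<And>i. i < n \<Longrightarrow> \<rho> i > 0"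
    and \<rho>_sum: "(\<Sum>i<n. \<rho> i) = 1"
  defines "q \<equiv> CARD('a)"
    and "\<Omega> \<equiv> channel n \<rho> g"
    and "EM \<equiv> \<lambda>i x. \<integral>\<omega>. S (M_count g i \<omega>) (\<rho> i * x) \<partial>\<Omega>"
    and "EM1 \<equiv> \<lambda>i x. \<integral>\<omega>. S (M_count g i \<omega> - 1) (\<rho> i * x) \<partial>\<Omega>"
  shows "((\<integral>\<^sup>+\<omega>. of_nat (W_total n g \<omega>) \<partial>\<Omega>)
           = (\<integral>\<^sup>+x\<in>{0..}. ennreal (1 - (\<Prod>i<n. 1 - exp (- \<rho> i * x) * EM i x)) \<partial>lborel)) \<and>
         ((\<integral>\<^sup>+\<omega>. of_nat (W_total n g \<omega>) \<partial>\<Omega>)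
           < ennreal (LBINT x:{0..}. 1 - (\<Prod>i<n. 1 - exp (- \<rho> i * x) *
                (S (g i) (\<rho> i * x) + alpha q (g i) * real q ^ g i * exp (\<rho> i * x / real q)
                 - alpha q (g i) * real q ^ g i * S (g i) (\<rho> i * x / real q))))) \<and>
         ((\<integral>\<^sup>+\<omega>. (of_nat (W_total n g \<omega>))\<^sup>2 \<partial>\<Omega>)
           = 2 * (\<integral>\<^sup>+x\<in>{0..}. ennreal (x * (1 - (\<Sum>i<n. \<rho> i *
                   (1 - EM1 i x * exp (- \<rho> i * x)) / (1 - EM i x * exp (- \<rho> i * x)) *
                   (\<Prod>j<n. 1 - EM j x * exp (- \<rho> j * x))))) \<partial>lborel)
             + (\<integral>\<^sup>+x\<in>{0..}. ennreal (1 - (\<Prod>i<n. 1 - exp (- \<rho> i * x) * EM i x)) \<partial>lborel))"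
proof -
  interpret C: generation_channel n g \<rho> \<Omega>
    by unfold_locales (use \<rho>_pos \<rho>_sum in \<open>auto simp: \<Omega>_def\<close>)
  let ?D = "\<lambda>i x. exp (- \<rho> i * x) * egf (C.span_prob i) (\<rho> i * x)"
  let ?D1 = "\<lambda>i x. exp (- \<rho> i * x) * egf (\<lambda>k. C.span_prob i (Suc k)) (\<rho> i * x)"
  have y: "0 \<le> \<rho> i * x" if "i < n" "0 \<le> x" for i x
    using that \<rho>_pos by (simp add: less_imp_le)
  have EM: "1 - exp (- \<rho> i * x) * EM i x = ?D i x" "1 - EM i x * exp (- \<rho> i * x) = ?D i x"
    if "i < n" "0 \<le> x" for i x
    using C.integral_S_M_count[OF that(1) y[OF that], of 0]
    by (simp_all add: EM_def exp_minus field_simps)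
  have EM1: "1 - EM1 i x * exp (- \<rho> i * x) = ?D1 i x" if "i < n" "0 \<le> x" for i x
    using C.integral_S_M_count[OF that(1) y[OF that], of 1]
    by (simp add: EM1_def exp_minus field_simps)
  have first: "(\<integral>\<^sup>+x\<in>{0..}. ennreal (1 - (\<Prod>i<n. 1 - exp (- \<rho> i * x) * EM i x)) \<partial>lborel)
      = (\<integral>\<^sup>+x\<in>{0..}. ennreal (1 - exp (- x) * egf C.success_prob x) \<partial>lborel)"
  proof (rule nn_integral_cong)
    fix x :: real
    have "(\<Prod>i<n. 1 - exp (- \<rho> i * x) * EM i x) = exp (- x) * egf C.success_prob x" if "0 \<le> x"
      unfolding C.exp_egf_success_prob by (rule prod.cong) (simp_all only: EM lessThan_iff that)
    then show "ennreal (1 - (\<Prod>i<n. 1 - exp (- \<rho> i * x) * EM i x)) * indicator {0..} x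
        = ennreal (1 - exp (- x) * egf C.success_prob x) * indicator {0..} x"
      by (cases "0 \<le> x") simp_all
  qed
  have bound: "C.miss_bound i y = exp (- y) *
      (S (g i) y + alpha q (g i) * real q ^ g i * exp (y / real q) - alpha q (g i) * real q ^ g i * S (g i) (y / real q))"
    if "i < n" for i y
  proof -
    have "2 \<le> CARD('a)"
      using card_mono[of UNIV "{0, 1::'a}"] by simp
    then interpret B: span_bound "CARD('a)" "g i"
      by unfold_locales (use g_pos[OF that] in auto)
    show ?thesis
      unfolding C.miss_bound_def q_def B.egf_b ..
  qed
  have second: "(\<integral>\<^sup>+x\<in>{0..}. ennreal (x * (1 - (\<Sum>i<n. \<rho> i *
        (1 - EM1 i x * exp (- \<rho> i * x)) / (1 - EM i x * exp (- \<rho> i * x)) *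
        (\<Prod>j<n. 1 - EM j x * exp (- \<rho> j * x))))) \<partial>lborel)
      = (\<integral>\<^sup>+x\<in>{0..}. ennreal (x * (1 - exp (- x) * egf (\<lambda>t. C.success_prob (Suc t)) x)) \<partial>lborel)"
  proof (rule nn_integral_cong)
    fix x :: real
    \<comment> \<open>At x = 0 the quotients may have denominator 0, but the weight x makes both
      integrands 0.\<close>
    consider "x < 0" | "x = 0" | "0 < x"
      by linarith
    then show "ennreal (x * (1 - (\<Sum>i<n. \<rho> i *
        (1 - EM1 i x * exp (- \<rho> i * x)) / (1 - EM i x * exp (- \<rho> i * x)) *
        (\<Prod>j<n. 1 - EM j x * exp (- \<rho> j * x))))) * indicator {0..} x
      = ennreal (x * (1 - exp (- x) * egf (\<lambda>t. C.success_prob (Suc t)) x)) * indicator {0..} x"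
    proof cases
      case 3
      then have "0 \<le> x"
        by simp
      have "(\<Prod>j<n. 1 - EM j x * exp (- \<rho> j * x)) = (\<Prod>j<n. ?D j x)"
        by (rule prod.cong) (simp_all only: EM lessThan_iff \<open>0 \<le> x\<close>)
      then have "(\<Sum>i<n. \<rho> i * (1 - EM1 i x * exp (- \<rho> i * x)) / (1 - EM i x * exp (- \<rho> i * x)) *
          (\<Prod>j<n. 1 - EM j x * exp (- \<rho> j * x))) = (\<Sum>i<n. \<rho> i * ?D1 i x / ?D i x * (\<Prod>j<n. ?D j x))"
        by (intro sum.cong) (simp_all only: EM EM1 lessThan_iff \<open>0 \<le> x\<close>)
      then show ?thesis
        by (simp only: C.exp_egf_success_prob_Suc[OF 3])
    qed simp_all
  qed
  have "(\<integral>\<^sup>+\<omega>. of_nat (W_total n g \<omega>) \<partial>\<Omega>)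
      < ennreal (LBINT x:{0..}. 1 - (\<Prod>i<n. 1 - exp (- \<rho> i * x) *
          (S (g i) (\<rho> i * x) + alpha q (g i) * real q ^ g i * exp (\<rho> i * x / real q)
           - alpha q (g i) * real q ^ g i * S (g i) (\<rho> i * x / real q))))"
  proof -
    have "(\<Prod>i<n. 1 - C.miss_bound i (\<rho> i * x)) = (\<Prod>i<n. 1 - exp (- \<rho> i * x) *
          (S (g i) (\<rho> i * x) + alpha q (g i) * real q ^ g i * exp (\<rho> i * x / real q)
           - alpha q (g i) * real q ^ g i * S (g i) (\<rho> i * x / real q)))" for x
      by (rule prod.cong) (simp_all add: bound)
    then show ?thesis
      using C.expectation_W_total_less[OF n g_pos] by simp
  qed
  then show ?thesis
    unfolding first second C.expectation_W_total_squared C.expectation_W_total by blast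
qed

end
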